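(* Let $\mathcal{X}$ be a nonempty Polish space, $\mathcal{Y}=\mathbb{R}^d$, $p>1$, let $\nu\in\mathcal{P}_p(\mathcal{Y})$ satisfy $\nu\ll\mathcal{L}^d$, and let $\phi:\mathcal{X}\to\mathcal{Y}$ be measurable and injective. Then minimizers of $\sigma\mapsto W_p^p(\phi\#\sigma,\nu)$ over $\sigma\in\mathcal{P}(\mathcal{X})$, if they exist, are unique (i.e. any two minimizers coincide) if and only if the problem is feasible, i.e. $\inf_{\sigma\in\mathcal{P}(\mathcal{X})}W_p^p(\phi\#\sigma,\nu)<+\infty$.
   Context: $\mathcal{P}(\cdot)$ denotes Borel probability measures, $\mathcal{P}_p(\mathcal{Y})$ those with finite $p$-th moment $\int|y|^p\,d\mu(y)$; $\mathcal{L}^d$ is Lebesgue measure on $\mathbb{R}^d$. $\phi\#\sigma$ is the pushforward of $\sigma$ by $\phi$. $W_p^p(\mu_1,\mu_2)=\inf_\Gamma\int|y'-y|^p\,d\Gamma(y',y)\in[0,\infty]$, the infimum over couplings of $\mu_1,\mu_2$. A minimizer is any $\sigma_*\in\mathcal{P}(\mathcal{X})$ attaining the infimum. *)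

theory Defs
  imports "HOL-Probability.Probability"
begin

definition borel_probs :: "'a::topological_space measure set" where
  "borel_probs = {\<mu>. prob_space \<mu> \<and> sets \<mu> = sets borel}"

definition borel_probs_moment :: "real \<Rightarrow> 'b::real_normed_vector measure set" where
  "borel_probs_moment p =
     {\<mu> \<in> borel_probs. (\<integral>\<^sup>+ y. ennreal (norm y powr p) \<partial>\<mu>) < \<infinity>}"

definition couplings ::
  "'b::topological_space measure \<Rightarrow> 'b measure \<Rightarrow> ('b \<times> 'b) measure set" where
  "couplings \<mu>1 \<mu>2 =
     {\<Gamma> \<in> borel_probs. distr \<Gamma> borel fst = \<mu>1 \<and> distr \<Gamma> borel snd = \<mu>2}"

text \<open>The \<open>p\<close>-th power of the Wasserstein distance, with values in \<open>[0, \<infinity>]\<close>.\<close>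

definition wasserstein_pow ::
  "real \<Rightarrow> 'b::real_normed_vector measure \<Rightarrow> 'b measure \<Rightarrow> ennreal" where
  "wasserstein_pow p \<mu>1 \<mu>2 =
     (INF \<Gamma> \<in> couplings \<mu>1 \<mu>2. \<integral>\<^sup>+ (y', y). ennreal (norm (y' - y) powr p) \<partial>\<Gamma>)"

definition objective ::
  "real \<Rightarrow> ('a::topological_space \<Rightarrow> 'b::real_normed_vector) \<Rightarrow> 'b measure \<Rightarrow> 'a measure \<Rightarrow> ennreal"
  where
  "objective p \<phi> \<nu> \<sigma> = wasserstein_pow p (distr \<sigma> borel \<phi>) \<nu>"

text \<open>If the infimum is \<open>\<infinity>\<close>, every Borel probability measure is a minimizer.\<close>

definition is_minimizer ::
  "real \<Rightarrow> ('a::topological_space \<Rightarrow> 'b::real_normed_vector) \<Rightarrow> 'b measure \<Rightarrow> 'a measure \<Rightarrow> bool"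
  where
  "is_minimizer p \<phi> \<nu> \<sigma> \<longleftrightarrow>
     \<sigma> \<in> borel_probs \<and> objective p \<phi> \<nu> \<sigma> = (INF \<tau> \<in> borel_probs. objective p \<phi> \<nu> \<tau>)"

definition feasible ::
  "real \<Rightarrow> ('a::topological_space \<Rightarrow> 'b::real_normed_vector) \<Rightarrow> 'b measure \<Rightarrow> bool"
  where
  "feasible p \<phi> \<nu> \<longleftrightarrow> (INF \<sigma> \<in> borel_probs. objective p \<phi> \<nu> \<sigma>) < \<infinity>"

end

theory Submission
  imports Defs
begin

text \<open>
  Feasibility always holds, since a Dirac mass has finite objective. For uniqueness, let
  \<open>\<Gamma>1\<close>, \<open>\<Gamma>2\<close> be optimal couplings for the images \<open>\<mu>1\<close>, \<open>\<mu>2\<close> of two minimizers. By linearity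
  their average \<open>\<Gamma>\<close> is again optimal, so its support \<open>S\<close> is monotone with respect to the cost under
  exchange of two pairs. This alone makes the set of \<open>y\<close> with several partners in \<open>S\<close>
  Lebesgue-null: near such a \<open>y\<close>, strict convexity of the cost gives a coordinate direction \<open>e\<close>
  such that a compact piece of the set contains no two points differing by a multiple of \<open>e\<close>, and a
  compact set with infinitely many disjoint translates in a bounded region is null. Hence, up to null
  sets, both \<open>\<Gamma>1\<close> and \<open>\<Gamma>2\<close> live on one graph over the second component, and \<open>\<mu>1 = \<mu>2\<close>. Finally,
  an injective Borel map is injective on measures: by Lusin's theorem it is continuous on compact
  sets of almost full measure, whose images are compact.
\<close>

section \<open>Sums of measures\<close>

text \<open>Averaging lets one argument treat both minimizers. The average of two minimizers is an
  admissible competitor, so its transport cost is at least the minimum, while the averaged coupling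
  costs exactly the minimum. Only exchanges of two pairs are used, and neither a potential nor a
  transport map is constructed: convexity of the cost is applied directly at the multivalued points.
  Measurability shapes the rest. The support is closed, so the part of it above a compact set
  projects to a closed set, and \<open>\<mu>1\<close> and \<open>\<mu>2\<close> are therefore
  compared on compact sets only. Injectivity of \<open>\<phi>\<close> is likewise used through
  compact sets, so images of general Borel sets never occur. Optimal couplings arise as limits of a
  minimizing sequence on Borel rectangles; fixing both marginals is what makes such setwise limits
  possible.\<close>

definition add_measure :: "'a measure \<Rightarrow> 'a measure \<Rightarrow> 'a measure" where
  "add_measure M N = measure_of (space M) (sets M) (\<lambda>A. emeasure M A + emeasure N A)"

lemma sets_add_measure [simp, measurable_cong]: "sets (add_measure M N) = sets M"
  by (simp add: add_measure_def sets.space_closed sets.sigma_sets_eq)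

lemma space_add_measure [simp]: "space (add_measure M N) = space M"
  by (rule sets_eq_imp_space_eq) simp

lemma emeasure_add_measure:
  assumes "sets M = sets N" and "A \<in> sets M"
  shows "emeasure (add_measure M N) A = emeasure M A + emeasure N A"
proof (rule emeasure_measure_of_sigma[of "space M" "sets M" "\<lambda>A. emeasure M A + emeasure N A",
      folded add_measure_def])
  show "sigma_algebra (space M) (sets M)" ..
  show "positive (sets M) (\<lambda>A. emeasure M A + emeasure N A)"
    by (simp add: positive_def)
  show "countably_additive (sets M) (\<lambda>A. emeasure M A + emeasure N A)"
  proof (rule countably_additiveI)
    fix B :: "nat \<Rightarrow> _"
    assume B: "range B \<subseteq> sets M" "disjoint_family B"
    have "(\<Sum>i. emeasure M (B i) + emeasure N (B i)) = (\<Sum>i. emeasure M (B i)) + (\<Sum>i. emeasure N (B i))"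
      by (rule suminf_add[symmetric]) (auto intro: summableI)
    also have "\<dots> = emeasure M (\<Union> (range B)) + emeasure N (\<Union> (range B))"
      using B assms(1) by (simp add: suminf_emeasure)
    finally show "(\<Sum>i. emeasure M (B i) + emeasure N (B i)) = emeasure M (\<Union> (range B)) + emeasure N (\<Union> (range B))" .
  qed
qed (fact assms)

lemma nn_integral_add_measure:
  assumes "sets M = sets N" and "f \<in> borel_measurable M"
  shows "(\<integral>\<^sup>+ x. f x \<partial>add_measure M N) = (\<integral>\<^sup>+ x. f x \<partial>M) + (\<integral>\<^sup>+ x. f x \<partial>N)"
  using assms(2)
proof induction
  case (cong f g)
  moreover have "space N = space M"
    using assms(1) by (rule sets_eq_imp_space_eq[symmetric])
  ultimately have "integral\<^sup>N K f = integral\<^sup>N K g" if "space K = space M" for K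
    using that by (intro nn_integral_cong) simp
  with cong \<open>space N = space M\<close> show ?case
    by simp
next
  case (set A)
  then show ?case
    using assms(1) by (simp add: emeasure_add_measure)
next
  case (mult u c)
  moreover from mult have "u \<in> borel_measurable N" "u \<in> borel_measurable (add_measure M N)"
    using assms(1) by (simp_all cong: measurable_cong_sets)
  ultimately show ?case
    by (simp add: nn_integral_cmult distrib_left)
next
  case (add u v)
  moreover from add have "u \<in> borel_measurable N" "u \<in> borel_measurable (add_measure M N)"
    "v \<in> borel_measurable N" "v \<in> borel_measurable (add_measure M N)"
    using assms(1) by (simp_all cong: measurable_cong_sets)
  ultimately show ?case
    by (simp add: nn_integral_add ac_simps)
next
  case (seq U)
  from seq have m: "\<And>i. U i \<in> borel_measurable N" "\<And>i. U i \<in> borel_measurable (add_measure M N)"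
    using assms(1) by (simp_all cong: measurable_cong_sets)
  have inc: "incseq (\<lambda>i. \<integral>\<^sup>+ x. U i x \<partial>K)" for K
    using seq(3) by (auto simp: incseq_def le_fun_def intro!: nn_integral_mono)
  have "(\<integral>\<^sup>+ x. (SUP i. U i x) \<partial>add_measure M N) = (SUP i. (\<integral>\<^sup>+ x. U i x \<partial>M) + (\<integral>\<^sup>+ x. U i x \<partial>N))"
    using seq m by (simp add: nn_integral_monotone_convergence_SUP)
  also have "\<dots> = (SUP i. \<integral>\<^sup>+ x. U i x \<partial>M) + (SUP i. \<integral>\<^sup>+ x. U i x \<partial>N)"
    using inc by (intro ennreal_SUP_add) auto
  finally show ?case
    using seq m by (simp add: nn_integral_monotone_convergence_SUP SUP_apply image_comp)
qed

section \<open>Lusin's theorem and injective images of measures\<close>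

lemma inner_regularE:
  fixes M :: "'a::{second_countable_topology, complete_space} measure"
  assumes M: "sets M = sets borel" "finite_measure M"
    and B: "B \<in> sets borel" and e: "e > 0"
  obtains K where "compact K" "K \<subseteq> B" "measure M (B - K) < e"
proof -
  interpret finite_measure M by fact
  have fin: "emeasure M (space M) \<noteq> \<infinity>" by simp
  have "\<exists>K. compact K \<and> K \<subseteq> B \<and> measure M (B - K) < e"
  proof (rule ccontr)
    assume H: "\<nexists>K. compact K \<and> K \<subseteq> B \<and> measure M (B - K) < e"
    have "emeasure M K \<le> ennreal (measure M B - e)" if "compact K" "K \<subseteq> B" for K
    proof -
      have K: "K \<in> sets borel" using that by (simp add: borel_compact)
      have "e \<le> measure M (B - K)" using H that by (meson not_less)
      also have "\<dots> = measure M B - measure M K"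
        using that K B M by (intro finite_measure_Diff) auto
      finally have "measure M K \<le> measure M B - e" by simp
      then show ?thesis by (simp add: emeasure_eq_measure ennreal_leI)
    qed
    then have "emeasure M B \<le> ennreal (measure M B - e)"
      unfolding inner_regular[OF M(1) fin B] by (intro SUP_least) auto
    \<comment> \<open>\<open>ennreal\<close> truncates negative reals to 0, so the bound is
      contradictory only if \<open>measure M B - e\<close> is nonnegative. The empty set, taken as a
      compact subset in \<open>H\<close>, provides that.\<close>
    moreover have "emeasure M {} = 0" "compact {}" "{} \<subseteq> B" by auto
    then have "e \<le> measure M B" using H by (metis Diff_empty not_less)
    ultimately show False using e by (simp add: emeasure_eq_measure)
  qed
  then show ?thesis using that by blast
qed

lemma measure_eqI_compact:
  fixes M N :: "'a::{second_countable_topology, complete_space} measure"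
  assumes M: "sets M = sets borel" "finite_measure M"
    and N: "sets N = sets borel" "finite_measure N"
    and eq: "\<And>K. compact K \<Longrightarrow> emeasure M K = emeasure N K"
  shows "M = N"
proof (rule measure_eqI)
  fix A assume "A \<in> sets M"
  then have A: "A \<in> sets borel" using M by simp
  have "emeasure M (space M) \<noteq> \<infinity>" "emeasure N (space N) \<noteq> \<infinity>"
    using M N by (auto simp: finite_measure.emeasure_finite)
  from inner_regular[OF M(1) this(1) A] inner_regular[OF N(1) this(2) A] eq
  show "emeasure M A = emeasure N A" by simp
qed (use M N in simp)

text \<open>For every basic open set, the part of \<open>B\<close> mapped into it and the rest are
  both approximated from inside, by compact sets \<open>P n\<close> and \<open>Q n\<close>. On the
  intersection \<open>K\<close> of all \<open>P n \<union> Q n\<close>, the preimage of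
  \<open>U n\<close> is the trace of the open set \<open>- Q n\<close>, and this is continuity of
  the restriction.\<close>

lemma lusin_compact:
  fixes M :: "'a::{second_countable_topology, complete_space} measure"
    and f :: "'a \<Rightarrow> 'b::second_countable_topology"
  assumes M: "sets M = sets borel" "finite_measure M"
    and f: "f \<in> borel_measurable borel" and B: "B \<in> sets borel" and e: "e > 0"
  obtains K where "compact K" "K \<subseteq> B" "continuous_on K f" "measure M (B - K) < e"
proof -
  interpret finite_measure M by fact
  obtain U :: "nat \<Rightarrow> 'b set" where U: "topological_basis (range U)"
  proof -
    obtain \<B> :: "'b set set" where \<B>: "countable \<B>" "topological_basis \<B>"
      using ex_countable_basis by blast
    have "\<B> \<noteq> {}" using \<B>(2) unfolding topological_basis_def
      by (metis UNIV_not_empty Union_empty open_UNIV subset_empty)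
    then show ?thesis using \<B> that by (metis range_from_nat_into)
  qed
  have oU: "open (U n)" for n using U topological_basis_open by blast
  have mU: "B \<inter> f -` U n \<in> sets borel" "B - f -` U n \<in> sets borel" for n
    using measurable_sets[OF f, of "U n"] oU[of n] B by auto
  \<comment> \<open>Each of \<open>P n\<close> and \<open>Q n\<close> loses less than
    \<open>d n\<close>. The two losses add up to at most \<open>e/2 * (1/2) ^ Suc n\<close>, and
    this series sums to \<open>e/2\<close>, which leaves room for the strict inequality.\<close>
  define d where "d n = e / 2 / 2 ^ Suc (Suc n)" for n :: nat
  have d: "d n > 0" for n using e by (simp add: d_def)
  have "\<exists>K. compact K \<and> K \<subseteq> B \<inter> f -` U n \<and> measure M ((B \<inter> f -` U n) - K) < d n" for n
    using inner_regularE[OF M mU(1) d] by metis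
  then obtain P where P: "\<And>n. compact (P n)" "\<And>n. P n \<subseteq> B \<inter> f -` U n"
    "\<And>n. measure M ((B \<inter> f -` U n) - P n) < d n" by metis
  have "\<exists>K. compact K \<and> K \<subseteq> B - f -` U n \<and> measure M ((B - f -` U n) - K) < d n" for n
    using inner_regularE[OF M mU(2) d] by metis
  then obtain Q where Q: "\<And>n. compact (Q n)" "\<And>n. Q n \<subseteq> B - f -` U n"
    "\<And>n. measure M ((B - f -` U n) - Q n) < d n" by metis
  have mPQ: "P n \<in> sets M" "Q n \<in> sets M" for n using P Q M by (auto simp: borel_compact)
  have mU': "B \<inter> f -` U n \<in> sets M" "B - f -` U n \<in> sets M" "B \<in> sets M" for n
    using mU M B by auto
  define K where "K = (\<Inter>n. P n \<union> Q n)"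
  have cK: "compact K"
  proof -
    have "K = (P 0 \<union> Q 0) \<inter> K" by (auto simp: K_def)
    moreover have "closed K"
      unfolding K_def using P Q by (intro closed_INT closed_Un ballI) (auto intro: compact_imp_closed)
    ultimately show ?thesis
      using compact_Int_closed[OF compact_Un[OF P(1)[of 0] Q(1)[of 0]], of K] by simp
  qed
  have KB: "K \<subseteq> B" using P(2)[of 0] Q(2)[of 0] unfolding K_def by blast
  have cont: "continuous_on K f"
    unfolding continuous_on_open_invariant
  proof (intro allI impI)
    fix V :: "'b set" assume "open V"
    then obtain J where J: "V = (\<Union>n\<in>J. U n)"
    proof -
      from \<open>open V\<close> obtain \<C> where "\<C> \<subseteq> range U" "\<Union>\<C> = V"
        using U unfolding topological_basis_def by blast
      then show ?thesis using that by (metis subset_image_iff)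
    qed
    have "f -` U n \<inter> K = - Q n \<inter> K" for n
      using P(2)[of n] Q(2)[of n] by (auto simp: K_def)
    then have "(\<Union>n\<in>J. - Q n) \<inter> K = f -` V \<inter> K" unfolding J by blast
    moreover have "open (\<Union>n\<in>J. - Q n)"
      using Q(1) by (auto simp: open_Compl compact_imp_closed)
    ultimately show "\<exists>A. open A \<and> A \<inter> K = f -` V \<inter> K" by blast
  qed
  have "measure M (B - (P n \<union> Q n)) \<le> d n + d n" for n
  proof -
    have "B - (P n \<union> Q n) \<subseteq> ((B \<inter> f -` U n) - P n) \<union> ((B - f -` U n) - Q n)" by auto
    then have "measure M (B - (P n \<union> Q n)) \<le> measure M (((B \<inter> f -` U n) - P n) \<union> ((B - f -` U n) - Q n))"
      using mPQ mU' by (intro finite_measure_mono) auto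
    also have "\<dots> \<le> measure M ((B \<inter> f -` U n) - P n) + measure M ((B - f -` U n) - Q n)"
      using mPQ mU' by (intro measure_Un_le) auto
    finally show ?thesis using P(3)[of n] Q(3)[of n] by linarith
  qed
  then have bnd: "measure M (B - (P n \<union> Q n)) \<le> e/2 * (1/2) ^ Suc n" for n
    using \<open>\<And>n. measure M (B - (P n \<union> Q n)) \<le> d n + d n\<close>[of n] by (simp add: d_def power_divide field_simps)
  have "(\<lambda>n. e/2 * (1/2) ^ Suc n) sums (e/2 * 1)"
    by (intro sums_mult power_half_series)
  then have sm: "summable (\<lambda>n. e/2 * (1/2) ^ Suc n)" "(\<Sum>n. e/2 * (1/2) ^ Suc n) = e/2"
    by (auto simp: sums_iff)
  have sm': "summable (\<lambda>n. measure M (B - (P n \<union> Q n)))"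
    by (rule summable_comparison_test'[OF sm(1), of 0]) (use bnd in auto)
  have eq: "B - K = (\<Union>n. B - (P n \<union> Q n))" by (auto simp: K_def)
  have "measure M (B - K) \<le> (\<Sum>n. measure M (B - (P n \<union> Q n)))"
    unfolding eq using mPQ mU' sm' by (intro finite_measure_subadditive_countably) auto
  also have "\<dots> \<le> (\<Sum>n. e/2 * (1/2) ^ Suc n)"
    by (intro suminf_le bnd sm sm')
  also have "\<dots> = e/2"
    by (rule sm)
  finally show ?thesis using that[OF cK KB cont] e by simp
qed

text \<open>A compact \<open>K\<close> on which \<open>f\<close> is continuous replaces
  \<open>A\<close>: its image is compact, hence Borel, and by injectivity \<open>K\<close> is the
  full preimage of that image. As \<open>K\<close> is adapted to \<open>M\<close> alone, only an
  inequality results; exchanging \<open>M\<close> and \<open>N\<close> gives the other one.\<close>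

lemma distr_inj_eq_imp_le:
  fixes M N :: "'a::{second_countable_topology, complete_space} measure"
    and f :: "'a \<Rightarrow> 'b::{second_countable_topology, t2_space}"
  assumes M: "sets M = sets borel" "finite_measure M"
    and N: "sets N = sets borel" "finite_measure N"
    and f: "f \<in> borel_measurable borel" "inj f"
    and eq: "distr M borel f = distr N borel f" and A: "A \<in> sets borel"
  shows "measure M A \<le> measure N A"
proof (rule field_le_epsilon)
  fix e :: real assume "e > 0"
  obtain K where K: "compact K" "K \<subseteq> A" "continuous_on K f" "measure M (A - K) < e"
    using lusin_compact[OF M f(1) A \<open>e > 0\<close>] .
  have K': "K \<in> sets borel" using K by (simp add: borel_compact)
  have fK: "f ` K \<in> sets borel" using compact_continuous_image[OF K(3,1)] by (simp add: borel_compact)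
  have mf: "f \<in> borel_measurable M" "f \<in> borel_measurable N"
    using f M N by (simp_all cong: measurable_cong_sets)
  have sp: "space M = UNIV" "space N = UNIV" using M N by (auto dest: sets_eq_imp_space_eq)
  have pre: "f -` f ` K = K" using f(2) by (rule inj_vimage_image_eq)
  have "measure M K = measure (distr M borel f) (f ` K)"
    using mf fK sp pre by (simp add: measure_distr)
  also have "\<dots> = measure N K"
    using mf fK sp pre unfolding eq by (simp add: measure_distr)
  finally have MN: "measure M K = measure N K" .
  have "measure M A = measure M K + measure M (A - K)"
    using finite_measure.finite_measure_Diff[OF M(2), of A K] K K' A M by simp
  moreover have "measure N K \<le> measure N A"
    using N A K by (intro finite_measure.finite_measure_mono) auto
  ultimately show "measure M A \<le> measure N A + e" using K(4) MN by linarith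
qed

lemma distr_inj_eqD:
  fixes M N :: "'a::{second_countable_topology, complete_space} measure"
    and f :: "'a \<Rightarrow> 'b::{second_countable_topology, t2_space}"
  assumes M: "sets M = sets borel" "finite_measure M"
    and N: "sets N = sets borel" "finite_measure N"
    and f: "f \<in> borel_measurable borel" "inj f"
    and eq: "distr M borel f = distr N borel f"
  shows "M = N"
proof (rule measure_eqI)
  fix A assume "A \<in> sets M"
  then have "A \<in> sets borel" using M by simp
  then have "measure M A = measure N A"
    using distr_inj_eq_imp_le[OF M N f eq] distr_inj_eq_imp_le[OF N M f eq[symmetric]]
    by (intro antisym) auto
  then show "emeasure M A = emeasure N A"
    using M N by (simp add: finite_measure.emeasure_eq_measure)
qed (use M N in simp)

section \<open>Existence of optimal couplings\<close>

text \<open>The index set will be the family of all sets of pairs, so the cube is compact but a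
  convergent subsequence need not exist. A proper filter finer than \<open>sequentially\<close>
  takes its place.\<close>

lemma sequence_cluster_filter:
  fixes f :: "nat \<Rightarrow> 'i \<Rightarrow> real"
  assumes f: "\<And>n i. f n i \<in> {0..1}"
  obtains L H where "H \<noteq> bot" "H \<le> sequentially" "\<And>i. ((\<lambda>n. f n i) \<longlongrightarrow> L i) H"
proof -
  have "compact (PiE UNIV (\<lambda>_::'i. {0..1::real}))"
    using compactin_PiE[of "\<lambda>_::'i. euclidean :: real topology" UNIV "\<lambda>_. {0..1}"]
    by (simp add: euclidean_product_topology)
  moreover have "filtermap f sequentially \<noteq> bot"
    by (simp add: filtermap_bot_iff)
  moreover have "eventually (\<lambda>x. x \<in> PiE UNIV (\<lambda>_::'i. {0..1::real})) (filtermap f sequentially)"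
    using f by (simp add: eventually_filtermap PiE_iff)
  ultimately obtain L where L: "inf (nhds L) (filtermap f sequentially) \<noteq> bot"
    unfolding compact_filter by blast
  \<comment> \<open>Pulling the neighbourhoods of the cluster point \<open>L\<close> back along
    \<open>f\<close> forces convergence; the meet with \<open>sequentially\<close> is proper because
    \<open>L\<close> is a cluster point.\<close>
  define H where "H = inf sequentially (filtercomap f (nhds L))"
  show ?thesis
  proof
    show "H \<noteq> bot"
    proof
      assume "H = bot"
      then have "eventually (\<lambda>_. False) H" by simp
      then obtain P Q where PQ: "eventually P sequentially" "eventually Q (filtercomap f (nhds L))"
        "\<And>n. P n \<Longrightarrow> Q n \<Longrightarrow> False"
        unfolding H_def eventually_inf by auto
      then obtain R where R: "eventually R (nhds L)" "\<And>n. R (f n) \<Longrightarrow> Q n"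
        unfolding eventually_filtercomap by auto
      have "eventually (\<lambda>y. \<exists>n. y = f n \<and> P n) (filtermap f sequentially)"
        unfolding eventually_filtermap using PQ(1) by eventually_elim auto
      with R(1) have "eventually (\<lambda>_. False) (inf (nhds L) (filtermap f sequentially))"
        unfolding eventually_inf using R(2) PQ(3) by blast
      with L show False by (simp add: trivial_limit_def)
    qed
    show "H \<le> sequentially" by (simp add: H_def)
    have *: "filterlim f (nhds L) H"
      unfolding H_def filterlim_def
      by (metis filtermap_filtercomap filtermap_mono inf_le2 order_trans)
    show "((\<lambda>n. f n i) \<longlongrightarrow> L i) H" for i
    proof -
      have "continuous_on UNIV (\<lambda>g::'i \<Rightarrow> real. g i)" by (rule continuous_on_product_coordinates)
      from continuous_on_tendsto_compose[OF this *] show ?thesis by simp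
    qed
  qed
qed

section \<open>The ring generated by Borel rectangles\<close>

definition borel_rectangles :: "('a::topological_space \<times> 'b::topological_space) set set" where
  "borel_rectangles = {A \<times> B | A B. A \<in> sets borel \<and> B \<in> sets borel}"

interpretation borel_rectangles: semiring_of_sets UNIV
  "borel_rectangles :: ('a::topological_space \<times> 'b::topological_space) set set"
proof
  show "borel_rectangles \<subseteq> Pow (UNIV :: ('a \<times> 'b) set)" by simp
  show "{} \<in> (borel_rectangles :: ('a \<times> 'b) set set)"
    unfolding borel_rectangles_def by (rule CollectI, rule exI[of _ "{}"]) auto
  fix X Y :: "('a \<times> 'b) set"
  assume "X \<in> borel_rectangles" "Y \<in> borel_rectangles"
  then obtain A B A' B' where X: "X = A \<times> B" "A \<in> sets borel" "B \<in> sets borel"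
    and Y: "Y = A' \<times> B'" "A' \<in> sets borel" "B' \<in> sets borel"
    unfolding borel_rectangles_def by auto
  show "X \<inter> Y \<in> borel_rectangles"
  proof -
    have "X \<inter> Y = (A \<inter> A') \<times> (B \<inter> B')" using X Y by auto
    moreover have "A \<inter> A' \<in> sets borel" "B \<inter> B' \<in> sets borel" using X Y by auto
    ultimately show ?thesis unfolding borel_rectangles_def by blast
  qed
  have "{(A - A') \<times> B, (A \<inter> A') \<times> (B - B')} \<subseteq> borel_rectangles"
    using X Y unfolding borel_rectangles_def by auto
  moreover have "disjoint {(A - A') \<times> B, (A \<inter> A') \<times> (B - B')}"
    by (auto simp: disjoint_def)
  moreover have "X - Y = \<Union> {(A - A') \<times> B, (A \<inter> A') \<times> (B - B')}"
    using X Y by auto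
  ultimately show "\<exists>C\<subseteq>borel_rectangles. finite C \<and> disjoint C \<and> X - Y = \<Union> C"
    by (meson finite.emptyI finite_insert)
qed

abbreviation rect_ring :: "('a::topological_space \<times> 'b::topological_space) set set" where
  "rect_ring \<equiv> borel_rectangles.generated_ring"

interpretation rect_ring: ring_of_sets UNIV
  "rect_ring :: ('a::topological_space \<times> 'b::topological_space) set set"
  by (rule borel_rectangles.generating_ring)

text \<open>Second countability makes the Borel sets of the product coincide with the product
  sigma-algebra.\<close>

lemma sigma_sets_rect_ring:
  "sigma_sets UNIV (rect_ring :: ('a::second_countable_topology \<times> 'b::second_countable_topology) set set)
     = sets borel"
  unfolding borel_rectangles.sigma_sets_generated_ring_eq borel_prod[symmetric] sets_pair_measure
  by (simp add: borel_rectangles_def)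

lemma Times_in_rect_ring: "A \<in> sets borel \<Longrightarrow> B \<in> sets borel \<Longrightarrow> A \<times> B \<in> rect_ring"
  by (intro borel_rectangles.generated_ringI_Basic) (auto simp: borel_rectangles_def)

lemma UNIV_in_rect_ring: "UNIV \<in> rect_ring"
  using Times_in_rect_ring[of UNIV UNIV] by simp

lemma rect_ring_borel:
  fixes E :: "('a::second_countable_topology \<times> 'b::second_countable_topology) set"
  shows "E \<in> rect_ring \<Longrightarrow> E \<in> sets borel"
  unfolding sigma_sets_rect_ring[symmetric] by auto

section \<open>Couplings and their marginals\<close>

lemma couplingsD:
  assumes "\<Gamma> \<in> couplings \<mu> \<nu>"
  shows "prob_space \<Gamma>" "sets \<Gamma> = sets borel" "space \<Gamma> = UNIV"
    "distr \<Gamma> borel fst = \<mu>" "distr \<Gamma> borel snd = \<nu>"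
  using assms sets_eq_imp_space_eq[of \<Gamma> borel] by (auto simp: couplings_def borel_probs_def)

lemma
  fixes \<mu> \<nu> :: "'b::second_countable_topology measure"
  assumes \<Gamma>: "\<Gamma> \<in> couplings \<mu> \<nu>" and A: "A \<in> sets borel"
  shows emeasure_coupling_fst: "emeasure \<Gamma> (A \<times> UNIV) = emeasure \<mu> A"
    and emeasure_coupling_snd: "emeasure \<Gamma> (UNIV \<times> A) = emeasure \<nu> A"
proof -
  note D = couplingsD[OF \<Gamma>]
  have [measurable]: "fst \<in> borel_measurable \<Gamma>" "snd \<in> borel_measurable \<Gamma>"
    using D(2) by (auto simp: borel_prod[symmetric] cong: measurable_cong_sets)
  show "emeasure \<Gamma> (A \<times> UNIV) = emeasure \<mu> A"
    using A unfolding D(4)[symmetric] by (subst emeasure_distr) (auto simp: D(3) intro!: arg_cong[where f = "emeasure \<Gamma>"])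
  show "emeasure \<Gamma> (UNIV \<times> A) = emeasure \<nu> A"
    using A unfolding D(5)[symmetric] by (subst emeasure_distr) (auto simp: D(3) intro!: arg_cong[where f = "emeasure \<Gamma>"])
qed

lemma couplingsI:
  fixes \<mu> \<nu> :: "'b::second_countable_topology measure"
  assumes "sets \<Gamma> = sets borel" "\<mu> \<in> borel_probs" "\<nu> \<in> borel_probs"
    and 1: "\<And>A. A \<in> sets borel \<Longrightarrow> emeasure \<Gamma> (A \<times> UNIV) = emeasure \<mu> A"
    and 2: "\<And>A. A \<in> sets borel \<Longrightarrow> emeasure \<Gamma> (UNIV \<times> A) = emeasure \<nu> A"
  shows "\<Gamma> \<in> couplings \<mu> \<nu>"
proof -
  have sp: "space \<Gamma> = UNIV" using assms(1) by (auto dest: sets_eq_imp_space_eq)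
  have [measurable]: "fst \<in> borel_measurable \<Gamma>" "snd \<in> borel_measurable \<Gamma>"
    using assms(1) by (auto simp: borel_prod[symmetric] cong: measurable_cong_sets)
  have \<mu>: "prob_space \<mu>" "sets \<mu> = sets borel" "space \<mu> = UNIV" and \<nu>: "sets \<nu> = sets borel"
    using assms(2,3) sets_eq_imp_space_eq[of \<mu> borel] by (auto simp: borel_probs_def)
  have "prob_space \<Gamma>"
    using 1[of UNIV] prob_space.emeasure_space_1[OF \<mu>(1)] \<mu>(3) sp by (intro prob_spaceI) simp
  moreover have "distr \<Gamma> borel fst = \<mu>"
  proof (rule measure_eqI)
    fix A :: "'b set" assume "A \<in> sets (distr \<Gamma> borel fst)"
    then show "emeasure (distr \<Gamma> borel fst) A = emeasure \<mu> A"
      using 1[of A] by (subst emeasure_distr) (auto simp: sp vimage_fst)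
  qed (use \<mu> in simp)
  moreover have "distr \<Gamma> borel snd = \<nu>"
  proof (rule measure_eqI)
    fix A :: "'b set" assume "A \<in> sets (distr \<Gamma> borel snd)"
    then show "emeasure (distr \<Gamma> borel snd) A = emeasure \<nu> A"
      using 2[of A] by (subst emeasure_distr) (auto simp: sp vimage_snd)
  qed (use \<nu> in simp)
  ultimately show ?thesis using assms(1) by (simp add: couplings_def borel_probs_def)
qed

text \<open>The bound is uniform in \<open>\<Gamma>\<close>: shrinking a rectangle
  \<open>A \<times> B\<close> to \<open>K \<times> K'\<close> loses at most the mass of
  \<open>A - K\<close> under \<open>\<mu>\<close> plus that of \<open>B - K'\<close> under
  \<open>\<nu>\<close>, whatever the coupling.\<close>

lemma rect_ring_inner_compact:
  fixes \<mu> \<nu> :: "'b::euclidean_space measure"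
  assumes \<mu>: "\<mu> \<in> borel_probs" and \<nu>: "\<nu> \<in> borel_probs" and E: "E \<in> rect_ring" and "e > 0"
  obtains C where "C \<in> rect_ring" "C \<subseteq> E" "compact C"
    "\<And>\<Gamma>. \<Gamma> \<in> couplings \<mu> \<nu> \<Longrightarrow> measure \<Gamma> (E - C) < e"
proof -
  from E obtain R where R: "finite R" "R \<subseteq> borel_rectangles" "E = \<Union>R"
    by (rule borel_rectangles.generated_ringE) auto
  have "\<exists>C\<in>rect_ring. C \<subseteq> \<Union>R \<and> compact C \<and> (\<forall>\<Gamma>\<in>couplings \<mu> \<nu>. measure \<Gamma> (\<Union>R - C) < e)"
    using R(1,2) \<open>e > 0\<close>
  proof (induction R arbitrary: e)
    case empty
    then show ?case by (intro bexI[of _ "{}"]) auto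
  next
    case (insert X R)
    from insert.IH[of "e/2"] insert.prems obtain C where C: "C \<in> rect_ring" "C \<subseteq> \<Union>R" "compact C"
      "\<And>\<Gamma>. \<Gamma> \<in> couplings \<mu> \<nu> \<Longrightarrow> measure \<Gamma> (\<Union>R - C) < e/2" by auto
    from insert.prems obtain A B where X: "X = A \<times> B" "A \<in> sets borel" "B \<in> sets borel"
      by (auto simp: borel_rectangles_def)
    have fm: "sets \<mu> = sets borel" "finite_measure \<mu>" "sets \<nu> = sets borel" "finite_measure \<nu>"
      using \<mu> \<nu> by (auto simp: borel_probs_def prob_space_def)
    \<comment> \<open>Two marginal losses below \<open>e/4\<close> join the loss below
      \<open>e/2\<close> from the remaining rectangles.\<close>
    have e4: "e/4 > 0" using insert.prems by simp
    obtain K where K: "compact K" "K \<subseteq> A" "measure \<mu> (A - K) < e/4"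
      using inner_regularE[OF fm(1,2) X(2) e4] .
    obtain K' where K': "compact K'" "K' \<subseteq> B" "measure \<nu> (B - K') < e/4"
      using inner_regularE[OF fm(3,4) X(3) e4] .
    have bK: "K \<in> sets borel" "K' \<in> sets borel" using K K' by (auto simp: borel_compact)
    have "measure \<Gamma> (\<Union>(insert X R) - (K \<times> K' \<union> C)) < e" if \<Gamma>: "\<Gamma> \<in> couplings \<mu> \<nu>" for \<Gamma>
    proof -
      note D = couplingsD[OF \<Gamma>]
      interpret prob_space \<Gamma> by (rule D)
      have m: "(A - K) \<times> UNIV \<in> sets \<Gamma>" "UNIV \<times> (B - K') \<in> sets \<Gamma>" "\<Union>R - C \<in> sets \<Gamma>"
        using X bK insert.prems(1) insert.hyps C(1) unfolding D(2)
        by (auto intro!: rect_ring_borel Times_in_rect_ring rect_ring.Diff rect_ring.finite_Union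
            intro: borel_rectangles.generated_ringI_Basic)
      have "measure \<Gamma> (\<Union>(insert X R) - (K \<times> K' \<union> C))
          \<le> measure \<Gamma> (((A - K) \<times> UNIV \<union> UNIV \<times> (B - K')) \<union> (\<Union>R - C))"
        using m X by (intro finite_measure_mono) auto
      also have "\<dots> \<le> measure \<Gamma> ((A - K) \<times> UNIV \<union> UNIV \<times> (B - K')) + measure \<Gamma> (\<Union>R - C)"
        using m by (intro measure_Un_le) auto
      also have "\<dots> \<le> measure \<Gamma> ((A - K) \<times> UNIV) + measure \<Gamma> (UNIV \<times> (B - K')) + measure \<Gamma> (\<Union>R - C)"
        using m by (intro add_right_mono measure_Un_le) auto
      also have "\<dots> = measure \<mu> (A - K) + measure \<nu> (B - K') + measure \<Gamma> (\<Union>R - C)"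
        using X bK by (simp add: measure_def emeasure_coupling_fst[OF \<Gamma>] emeasure_coupling_snd[OF \<Gamma>])
      finally show ?thesis using K K' C(4)[OF \<Gamma>] by linarith
    qed
    moreover have "K \<times> K' \<union> C \<in> rect_ring"
      using C bK by (intro rect_ring.Un Times_in_rect_ring)
    moreover have "K \<times> K' \<union> C \<subseteq> \<Union>(insert X R)" using X K K' C by auto
    moreover have "compact (K \<times> K' \<union> C)" using K K' C by (intro compact_Un compact_Times)
    ultimately show ?case by blast
  qed
  then show ?thesis using that R(3) by blast
qed

text \<open>
  Tychonoff's theorem gives a finitely additive limit on rectangles; as the marginals are fixed and
  inner regular, elements of the ring contain compact ones of almost the same mass, uniformly in the
  coupling, which makes the limit countably additive.
\<close>

lemma coupling_cluster:
  fixes \<mu> \<nu> :: "'b::euclidean_space measure"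
  assumes \<mu>: "\<mu> \<in> borel_probs" and \<nu>: "\<nu> \<in> borel_probs"
    and \<Gamma>: "\<And>n::nat. \<Gamma> n \<in> couplings \<mu> \<nu>"
  obtains \<Gamma>' H where "\<Gamma>' \<in> couplings \<mu> \<nu>" "H \<noteq> bot" "H \<le> sequentially"
    "\<And>E. E \<in> rect_ring \<Longrightarrow> ((\<lambda>n. measure (\<Gamma> n) E) \<longlongrightarrow> measure \<Gamma>' E) H"
proof -
  have prob: "prob_space (\<Gamma> n)" for n using \<Gamma> by (rule couplingsD)
  have setsG: "sets (\<Gamma> n) = sets borel" for n using \<Gamma> by (rule couplingsD)
  have fm: "finite_measure (\<Gamma> n)" for n using prob by (simp add: prob_space_def)
  \<comment> \<open>Here \<open>E\<close> is an arbitrary set, as \<open>measure\<close> is 0 on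
    non-measurable ones. The limit \<open>L\<close> is thus defined on all sets, while its
    additivity is claimed for Borel sets.\<close>
  have "measure (\<Gamma> n) E \<in> {0..1}" for n E
    using prob_space.prob_le_1[OF prob] by simp
  then obtain L H where H: "H \<noteq> bot" "H \<le> sequentially"
    and L: "\<And>E. ((\<lambda>n. measure (\<Gamma> n) E) \<longlongrightarrow> L E) H"
    by (rule sequence_cluster_filter[where f = "\<lambda>n. measure (\<Gamma> n)"]) blast
  have uniq: "L E = l" if "((\<lambda>n. measure (\<Gamma> n) E) \<longlongrightarrow> l) H" for E l
    using tendsto_unique[OF H(1) L that] .
  have L0: "0 \<le> L E" for E
    by (rule tendsto_lowerbound[OF L _ H(1)]) simp
  have L_Un: "L (A \<union> B) = L A + L B" if "A \<in> sets borel" "B \<in> sets borel" "A \<inter> B = {}" for A B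
  proof (rule uniq)
    have "measure (\<Gamma> n) (A \<union> B) = measure (\<Gamma> n) A + measure (\<Gamma> n) B" for n
      using that fm setsG by (intro finite_measure.finite_measure_Union) auto
    then show "((\<lambda>n. measure (\<Gamma> n) (A \<union> B)) \<longlongrightarrow> L A + L B) H"
      using tendsto_add[OF L L] by simp
  qed
  have L_mono: "L A \<le> L B" if "A \<in> sets borel" "B \<in> sets borel" "A \<subseteq> B" for A B
    using L_Un[of A "B - A"] L0[of "B - A"] that by (simp add: Un_absorb1)
  have L_sub: "L (\<Union>i\<in>I. A i) \<le> (\<Sum>i\<in>I. L (A i))"
    if "finite I" "\<And>i. i \<in> I \<Longrightarrow> A i \<in> sets borel" for A and I :: "nat set"
  proof (rule tendsto_le[OF H(1) tendsto_sum[OF L] L], rule always_eventually, rule allI)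
    fix n
    show "measure (\<Gamma> n) (\<Union>i\<in>I. A i) \<le> (\<Sum>i\<in>I. measure (\<Gamma> n) (A i))"
      using that setsG fm by (intro finite_measure.finite_measure_subadditive_finite) auto
  qed
  have L_fst: "L (A \<times> UNIV) = measure \<mu> A" and L_snd: "L (UNIV \<times> A) = measure \<nu> A"
    if "A \<in> sets borel" for A
    using that by (auto intro!: uniq simp: measure_def emeasure_coupling_fst[OF \<Gamma>] emeasure_coupling_snd[OF \<Gamma>])
  have L_UNIV: "L UNIV = 1"
    using prob_space.prob_space[OF prob] couplingsD(3)[OF \<Gamma>] by (intro uniq) simp
  \<comment> \<open>A finite additive set function on a ring extends to a measure once it tends to 0
    along decreasing sequences with empty intersection.\<close>
  have "\<exists>m. (\<forall>E\<in>rect_ring. m E = ennreal (L E)) \<and> measure_space UNIV (sigma_sets UNIV rect_ring) m"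
  proof (rule rect_ring.caratheodory_empty_continuous)
    show "positive rect_ring (\<lambda>E. ennreal (L E))"
      using prob uniq[of "{}" 0] by (simp add: positive_def)
    show "additive rect_ring (\<lambda>E. ennreal (L E))"
      using L_Un L0 by (auto simp: additive_def rect_ring_borel simp flip: ennreal_plus)
    fix E :: "nat \<Rightarrow> ('b \<times> 'b) set"
    assume E: "range E \<subseteq> rect_ring" "decseq E" "(\<Inter>i. E i) = {}"
    have bE: "E k \<in> sets borel" for k using E(1) by (auto intro: rect_ring_borel)
    have dec: "decseq (\<lambda>k. L (E k))"
      using E(2) bE by (auto simp: decseq_def intro!: L_mono)
    have "\<exists>k. L (E k) < e" if "e > 0" for e
    proof (rule ccontr)
      assume "\<nexists>k. L (E k) < e"
      then have ge: "e \<le> L (E k)" for k by (simp add: not_less)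
      \<comment> \<open>The losses \<open>d k\<close> sum to \<open>e/2\<close>, half of what every
        \<open>E k\<close> is assumed to keep. So no finite intersection \<open>D k\<close> of the
        compact cores is empty, and nested compactness yields a point common to all
        \<open>E k\<close>.\<close>
      define d where "d k = e / 2 * (1/2) ^ Suc k" for k
      have d: "d k > 0" for k using \<open>e > 0\<close> by (simp add: d_def)
      have "\<exists>C\<in>rect_ring. C \<subseteq> E k \<and> compact C \<and> (\<forall>\<Gamma>\<in>couplings \<mu> \<nu>. measure \<Gamma> (E k - C) < d k)" for k
        using rect_ring_inner_compact[OF \<mu> \<nu> _ d, of "E k"] E(1) by (metis range_subsetD)
      then obtain C where C: "\<And>k. C k \<in> rect_ring" "\<And>k. C k \<subseteq> E k" "\<And>k. compact (C k)"
        "\<And>k \<Gamma>. \<Gamma> \<in> couplings \<mu> \<nu> \<Longrightarrow> measure \<Gamma> (E k - C k) < d k" by metis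
      have bC: "C k \<in> sets borel" for k using C(1) by (rule rect_ring_borel)
      define D where "D k = (\<Inter>j\<le>k. C j)" for k
      have bD: "D k \<in> sets borel" for k using bC by (auto simp: D_def)
      have L_diff: "L (E k - C k) \<le> d k" for k
        using C(4)[OF \<Gamma>] by (intro tendsto_upperbound[OF L _ H(1)] always_eventually) (auto intro: less_imp_le)
      have "D k \<noteq> {}" for k
      proof
        assume "D k = {}"
        have "E k \<subseteq> (\<Union>j\<le>k. E j - C j)"
        proof
          fix z assume "z \<in> E k"
          moreover obtain j where "j \<le> k" "z \<notin> C j" using \<open>D k = {}\<close> by (auto simp: D_def)
          moreover have "E k \<subseteq> E j" using E(2) \<open>j \<le> k\<close> by (auto simp: decseq_def)
          ultimately show "z \<in> (\<Union>j\<le>k. E j - C j)" by blast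
        qed
        then have "L (E k) \<le> L (\<Union>j\<le>k. E j - C j)"
          using bE bC by (intro L_mono) auto
        also have "\<dots> \<le> (\<Sum>j\<le>k. L (E j - C j))" using bE bC by (intro L_sub) auto
        also have "\<dots> \<le> (\<Sum>j\<le>k. d j)" by (intro sum_mono L_diff)
        also have "\<dots> \<le> (\<Sum>j. d j)"
        proof (rule sum_le_suminf)
          have "d sums (e / 2 * 1)" unfolding d_def by (intro sums_mult power_half_series)
          then show "summable d" by (rule sums_summable)
        qed (use d in \<open>auto intro: less_imp_le\<close>)
        also have "\<dots> = e / 2 * 1"
          unfolding d_def by (intro sums_unique[symmetric] sums_mult power_half_series)
        finally show False using ge[of k] \<open>e > 0\<close> by simp
      qed
      moreover have "compact (D k)" for k
      proof -
        have "D k = C 0 \<inter> D k" by (auto simp: D_def)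
        moreover have "closed (D k)"
          using C(3) unfolding D_def by (intro closed_INT ballI compact_imp_closed)
        ultimately show ?thesis using compact_Int_closed[OF C(3)[of 0], of "D k"] by simp
      qed
      moreover have "D n \<subseteq> D m" if "m \<le> n" for m n using that by (auto simp: D_def)
      ultimately have "\<Inter>(range D) \<noteq> {}" by - (rule compact_nest)
      then obtain z where z: "\<And>k. z \<in> D k" by blast
      have "z \<in> E k" for k using z[of k] C(2)[of k] unfolding D_def by blast
      then have "z \<in> (\<Inter>i. E i)" by (rule INT_I)
      then show False using E(3) by simp
    qed
    then have "(\<lambda>k. L (E k)) \<longlonglongrightarrow> 0"
    proof -
      have "\<exists>N. \<forall>n\<ge>N. norm (L (E n) - 0) < e" if "e > 0" for e
      proof -
        obtain k where "L (E k) < e" using \<open>e > 0 \<Longrightarrow> \<exists>k. L (E k) < e\<close> \<open>e > 0\<close> by blast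
        then have "norm (L (E n) - 0) < e" if "n \<ge> k" for n
          using decseqD[OF dec that] L0[of "E n"] by simp
        then show ?thesis by blast
      qed
      then show ?thesis by (intro LIMSEQ_I)
    qed
    then show "(\<lambda>k. ennreal (L (E k))) \<longlonglongrightarrow> 0"
      using tendsto_ennrealI by fastforce
  qed simp
  then obtain m where m: "\<And>E. E \<in> rect_ring \<Longrightarrow> m E = ennreal (L E)"
    and ms: "measure_space UNIV (sets borel) m"
    unfolding sigma_sets_rect_ring by blast
  define \<Gamma>' where "\<Gamma>' = measure_of UNIV (sets borel) m"
  have sets': "sets \<Gamma>' = sets borel"
    using sets.sigma_sets_eq[of borel] by (simp add: \<Gamma>'_def)
  have em: "emeasure \<Gamma>' E = ennreal (L E)" if "E \<in> rect_ring" for E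
    using ms that m rect_ring_borel[OF that]
    unfolding \<Gamma>'_def measure_space_def by (subst emeasure_measure_of_sigma) auto
  have "\<Gamma>' \<in> couplings \<mu> \<nu>"
  proof (rule couplingsI[OF sets' \<mu> \<nu>])
    fix A :: "'b set" assume A: "A \<in> sets borel"
    have "finite_measure \<mu>" "finite_measure \<nu>"
      using \<mu> \<nu> by (auto simp: borel_probs_def prob_space_def)
    then show "emeasure \<Gamma>' (A \<times> UNIV) = emeasure \<mu> A" "emeasure \<Gamma>' (UNIV \<times> A) = emeasure \<nu> A"
      using A by (simp_all add: em Times_in_rect_ring L_fst L_snd finite_measure.emeasure_eq_measure)
  qed
  moreover have "((\<lambda>n. measure (\<Gamma> n) E) \<longlongrightarrow> measure \<Gamma>' E) H" if "E \<in> rect_ring" for E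
    using L[of E] em[OF that] L0[of E] by (simp add: measure_def)
  ultimately show ?thesis using that H by blast
qed

text \<open>A lower semicontinuous cost is a countable supremum of constants on borel rectangles, so its
  integral is lower semicontinuous along convergence on rectangles.\<close>

lemma lsc_cost_cluster:
  fixes c :: "'b::second_countable_topology \<times> 'b \<Rightarrow> ennreal"
  assumes c: "\<And>a. open {z. a < c z}"
    and \<Gamma>': "\<Gamma>' \<in> couplings \<mu> \<nu>" and \<Gamma>: "\<And>n::nat. \<Gamma> n \<in> couplings \<mu> \<nu>" and H: "H \<noteq> bot"
    and conv: "\<And>E. E \<in> rect_ring \<Longrightarrow> ((\<lambda>n. measure (\<Gamma> n) E) \<longlongrightarrow> measure \<Gamma>' E) H"
    and bnd: "eventually (\<lambda>n. (\<integral>\<^sup>+ z. c z \<partial>\<Gamma> n) \<le> b) H"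
  shows "(\<integral>\<^sup>+ z. c z \<partial>\<Gamma>') \<le> b"
proof -
  obtain \<B> :: "'b set set" where \<B>: "countable \<B>" "topological_basis \<B>"
    using ex_countable_basis by blast
  define T where "T = {(E, q). E \<in> (\<lambda>(A, B). A \<times> B) ` (\<B> \<times> \<B>) \<and> q \<in> range (\<lambda>r. ennreal (real_of_rat r)) \<and> (\<forall>z\<in>E. q \<le> c z)}"
  have "countable T"
  proof (rule countable_subset)
    show "T \<subseteq> ((\<lambda>(A, B). A \<times> B) ` (\<B> \<times> \<B>)) \<times> range (\<lambda>r. ennreal (real_of_rat r))"
      by (auto simp: T_def)
    show "countable (((\<lambda>(A, B). A \<times> B) ` (\<B> \<times> \<B>)) \<times> range (\<lambda>r. ennreal (real_of_rat r)))"
      using \<B>(1) by auto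
  qed
  have above: "\<exists>(E, q)\<in>T. z \<in> E \<and> t < q" if tz: "t < c z" for z t
  proof -
    obtain r where r: "t < ennreal (real_of_rat r)" "ennreal (real_of_rat r) < c z"
      using ennreal_rat_dense[OF tz] by blast
    have "z \<in> {z. ennreal (real_of_rat r) < c z}" using r by simp
    with c[of "ennreal (real_of_rat r)"] obtain U V where UV: "open U" "open V" "z \<in> U \<times> V"
      "U \<times> V \<subseteq> {z. ennreal (real_of_rat r) < c z}" by (rule open_prod_elim)
    obtain A where A: "A \<in> \<B>" "fst z \<in> A" "A \<subseteq> U"
      using topological_basisE[OF \<B>(2) UV(1), of "fst z"] UV(3) by (auto simp: mem_Times_iff)
    obtain B where B: "B \<in> \<B>" "snd z \<in> B" "B \<subseteq> V"
      using topological_basisE[OF \<B>(2) UV(2), of "snd z"] UV(3) by (auto simp: mem_Times_iff)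
    have "A \<times> B \<subseteq> {z. ennreal (real_of_rat r) < c z}" using A B UV(4) by blast
    then have "(A \<times> B, ennreal (real_of_rat r)) \<in> T"
      using A(1) B(1) unfolding T_def by (auto intro: less_imp_le)
    moreover have "z \<in> A \<times> B" using A B by (simp add: mem_Times_iff)
    ultimately show ?thesis
      using r(1) by (intro bexI[of _ "(A \<times> B, ennreal (real_of_rat r))"]) auto
  qed
  show ?thesis
  proof (cases "T = {}")
    case True
    then have "c z = 0" for z using above[of 0 z] by (auto simp: zero_less_iff_neq_zero)
    then show ?thesis by simp
  next
    case False
    define E where "E j = fst (from_nat_into T j)" for j
    define q where "q j = snd (from_nat_into T j)" for j
    have T: "(E j, q j) \<in> T" for j
      using from_nat_into[OF False] by (simp add: E_def q_def)
    have Er: "E j \<in> rect_ring" for j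
    proof -
      obtain A B where "A \<in> \<B>" "B \<in> \<B>" "E j = A \<times> B" using T[of j] by (auto simp: T_def)
      then show ?thesis using topological_basis_open[OF \<B>(2)] by (auto intro!: Times_in_rect_ring)
    qed
    have qt: "q j < \<top>" for j using T[of j] by (auto simp: T_def)
    define g where "g j z = q j * indicator (E j) z" for j z
    define s where "s k z = (SUP j\<in>{..k}. g j z)" for k :: nat and z
    have s_ge: "v \<le> s k z \<longleftrightarrow> (\<exists>j\<le>k. v \<le> g j z)" for v k z
    proof -
      have "s k z = Max ((\<lambda>j. g j z) ` {..k})"
        unfolding s_def by (subst Max_Sup) auto
      then show ?thesis by (auto simp: Max_ge_iff)
    qed
    have s_gt: "v < s k z \<longleftrightarrow> (\<exists>j\<le>k. v < g j z)" for v k z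
      by (auto simp: s_def less_SUP_iff)
    \<comment> \<open>Convergence is known on the ring only. As \<open>s k\<close> takes finitely
      many values, its integral is a finite sum over level sets, and it passes to the limit if these
      lie in the ring.\<close>
    have level: "{z. s k z = v} \<in> rect_ring" for k v
    proof -
      have 1: "{z. v \<le> g j z} \<in> rect_ring" for j
      proof -
        \<comment> \<open>Off \<open>E j\<close> the function \<open>g j\<close> is 0, so its
          superlevel set at 0 is everything.\<close>
        have "{z. v \<le> g j z} = (if v \<le> q j then E j else {}) \<union> (if v = 0 then UNIV else {})"
          by (auto simp: g_def indicator_def split: if_splits)
        then show ?thesis using Er UNIV_in_rect_ring by auto
      qed
      have 2: "{z. v < g j z} \<in> rect_ring" for j
      proof -
        have "{z. v < g j z} = (if v < q j then E j else {})"
          by (auto simp: g_def indicator_def split: if_splits)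
        then show ?thesis using Er by auto
      qed
      have "{z. s k z = v} = (\<Union>j\<le>k. {z. v \<le> g j z}) - (\<Union>j\<le>k. {z. v < g j z})"
      proof -
        have "s k z = v \<longleftrightarrow> (\<exists>j\<le>k. v \<le> g j z) \<and> \<not> (\<exists>j\<le>k. v < g j z)" for z
          unfolding s_ge[symmetric] s_gt[symmetric] by auto
        then show ?thesis by auto
      qed
      then show ?thesis using 1 2 by (auto intro!: rect_ring.Diff rect_ring.finite_UN)
    qed
    have fin: "finite (range (s k))" for k
    proof (rule finite_subset)
      show "range (s k) \<subseteq> insert 0 (q ` {..k})"
      proof safe
        fix z assume "s k z \<notin> q ` {..k}"
        have "s k z = Max ((\<lambda>j. g j z) ` {..k})"
          unfolding s_def by (subst Max_Sup) auto
        then have "s k z \<in> (\<lambda>j. g j z) ` {..k}" by (simp del: Max_in) (rule Max_in, auto)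
        then show "s k z = 0" using \<open>s k z \<notin> q ` {..k}\<close> by (auto simp: g_def indicator_def split: if_splits)
      qed
    qed simp
    \<comment> \<open>A coefficient \<open>\<top>\<close> would spoil the limit below, since
      multiplication by it is not continuous at 0.\<close>
    have s_top: "s k z < \<top>" for k z
      unfolding s_def by (subst Max_Sup[symmetric]) (auto simp: g_def indicator_def qt)
    have int_s: "(\<integral>\<^sup>+ z. s k z \<partial>M) = (\<Sum>v\<in>range (s k). v * emeasure M {z. s k z = v})"
      if "M \<in> couplings \<mu> \<nu>" for k M
    proof -
      have "simple_function M (s k)"
        using fin level couplingsD(2,3)[OF that]
        by (auto simp: simple_function_def vimage_def intro!: rect_ring_borel)
      then show ?thesis
        using couplingsD(3)[OF that]
        by (simp add: nn_integral_eq_simple_integral simple_integral_def vimage_def)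
    qed
    have le_c: "s k z \<le> c z" for k z
    proof -
      have "g j z \<le> c z" for j using T[of j] by (auto simp: T_def g_def indicator_def)
      then show ?thesis by (auto simp: s_def intro: SUP_least)
    qed
    have sup_c: "c z = (SUP k. s k z)" for z
    proof (rule antisym)
      show "c z \<le> (SUP k. s k z)"
      proof (rule dense_le)
        fix t assume "t < c z"
        then obtain E' q' where E': "(E', q') \<in> T" "z \<in> E'" "t < q'" using above by blast
        obtain j where j: "from_nat_into T j = (E', q')"
          using from_nat_into_surj[OF \<open>countable T\<close> E'(1)] by blast
        then have "t < s j z" using E' by (auto simp: s_gt g_def E_def q_def intro!: exI[of _ j])
        then show "t \<le> (SUP k. s k z)" by (meson UNIV_I SUP_upper2 less_imp_le)
      qed
      show "(SUP k. s k z) \<le> c z" using le_c by (rule SUP_least)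
    qed
    have mono_s: "incseq s"
      by (auto simp: incseq_def le_fun_def s_def intro!: SUP_subset_mono)
    have bs: "(\<integral>\<^sup>+ z. s k z \<partial>\<Gamma>') \<le> b" for k
    proof -
      have em: "emeasure M X = ennreal (measure M X)" if "M \<in> couplings \<mu> \<nu>" for M X
        using couplingsD(1)[OF that] by (simp add: prob_space_def finite_measure.emeasure_eq_measure)
      have "((\<lambda>n. \<integral>\<^sup>+ z. s k z \<partial>\<Gamma> n) \<longlongrightarrow> (\<integral>\<^sup>+ z. s k z \<partial>\<Gamma>')) H"
        unfolding int_s[OF \<Gamma>] int_s[OF \<Gamma>'] em[OF \<Gamma>] em[OF \<Gamma>']
        using s_top by (intro tendsto_sum ennreal_tendsto_cmult tendsto_ennrealI conv level) auto
      moreover have "eventually (\<lambda>n. (\<integral>\<^sup>+ z. s k z \<partial>\<Gamma> n) \<le> b) H"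
        using bnd by eventually_elim (auto intro: order_trans[OF nn_integral_mono] le_c)
      ultimately show ?thesis by (rule tendsto_upperbound) (rule H)
    qed
    have "(\<integral>\<^sup>+ z. c z \<partial>\<Gamma>') = (SUP k. \<integral>\<^sup>+ z. s k z \<partial>\<Gamma>')"
      unfolding sup_c
    proof (rule nn_integral_monotone_convergence_SUP[OF mono_s])
      fix k
      have "simple_function \<Gamma>' (s k)"
        using fin level couplingsD(2,3)[OF \<Gamma>']
        by (auto simp: simple_function_def vimage_def intro!: rect_ring_borel)
      then show "s k \<in> borel_measurable \<Gamma>'" by (rule borel_measurable_simple_function)
    qed
    also have "\<dots> \<le> b" using bs by (rule SUP_least)
    finally show ?thesis .
  qed
qed

section \<open>The direct method\<close>

lemma product_coupling:
  fixes \<mu> \<nu> :: "'b::second_countable_topology measure"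
  assumes \<mu>: "\<mu> \<in> borel_probs" and \<nu>: "\<nu> \<in> borel_probs"
  shows "\<mu> \<Otimes>\<^sub>M \<nu> \<in> couplings \<mu> \<nu>"
proof -
  interpret M: prob_space \<mu> using \<mu> by (simp add: borel_probs_def)
  interpret N: prob_space \<nu> using \<nu> by (simp add: borel_probs_def)
  have s: "sets \<mu> = sets borel" "sets \<nu> = sets borel" using \<mu> \<nu> by (auto simp: borel_probs_def)
  then have sp: "space \<mu> = UNIV" "space \<nu> = UNIV" by (auto dest: sets_eq_imp_space_eq)
  show ?thesis
  proof (rule couplingsI[OF _ \<mu> \<nu>])
    show "sets (\<mu> \<Otimes>\<^sub>M \<nu>) = sets borel"
      using s by (simp add: borel_prod[symmetric] cong: sets_pair_measure_cong)
    fix A :: "'b set" assume "A \<in> sets borel"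
    then show "emeasure (\<mu> \<Otimes>\<^sub>M \<nu>) (A \<times> UNIV) = emeasure \<mu> A" "emeasure (\<mu> \<Otimes>\<^sub>M \<nu>) (UNIV \<times> A) = emeasure \<nu> A"
      using s sp M.emeasure_space_1 N.emeasure_space_1 by (simp_all add: N.emeasure_pair_measure_Times)
  qed
qed

text \<open>A minimizing sequence has a cluster coupling, along which the cost is lower
  semicontinuous. Since \<open>lsc_cost_cluster\<close> takes one fixed bound, it is applied with
  \<open>I + e\<close> for each \<open>e > 0\<close>.\<close>

lemma optimal_coupling_exists:
  fixes \<mu> \<nu> :: "'b::euclidean_space measure" and c :: "'b \<times> 'b \<Rightarrow> ennreal"
  assumes \<mu>: "\<mu> \<in> borel_probs" and \<nu>: "\<nu> \<in> borel_probs" and c: "\<And>a. open {z. a < c z}"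
  obtains \<Gamma> where "\<Gamma> \<in> couplings \<mu> \<nu>"
    "(\<integral>\<^sup>+ z. c z \<partial>\<Gamma>) = (INF \<Gamma>\<in>couplings \<mu> \<nu>. \<integral>\<^sup>+ z. c z \<partial>\<Gamma>)"
proof -
  define I where "I = (INF \<Gamma>\<in>couplings \<mu> \<nu>. \<integral>\<^sup>+ z. c z \<partial>\<Gamma>)"
  have I_le: "I \<le> (\<integral>\<^sup>+ z. c z \<partial>\<Gamma>)" if "\<Gamma> \<in> couplings \<mu> \<nu>" for \<Gamma>
    using that unfolding I_def by (rule INF_lower)
  show ?thesis
  proof (cases "I = \<top>")
    \<comment> \<open>If every coupling costs \<open>\<top>\<close>, any coupling is optimal, and
      the product shows that there is one.\<close>
    case True
    then show ?thesis
      using that[OF product_coupling[OF \<mu> \<nu>]] I_le[OF product_coupling[OF \<mu> \<nu>]]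
      by (simp add: top_unique flip: I_def)
  next
    case False
    have "\<exists>\<Gamma>\<in>couplings \<mu> \<nu>. (\<integral>\<^sup>+ z. c z \<partial>\<Gamma>) < I + ennreal (inverse (real (Suc n)))" for n
    proof -
      have "I + 0 < I + ennreal (inverse (real (Suc n)))"
        using False by (subst ennreal_add_left_cancel_less) auto
      then show ?thesis by (simp add: INF_less_iff I_def)
    qed
    then have "\<forall>n. \<exists>\<Gamma>. \<Gamma> \<in> couplings \<mu> \<nu> \<and> (\<integral>\<^sup>+ z. c z \<partial>\<Gamma>) < I + ennreal (inverse (real (Suc n)))"
      by blast
    from choice[OF this] obtain \<Gamma> where \<Gamma>: "\<And>n::nat. \<Gamma> n \<in> couplings \<mu> \<nu>"
      "\<And>n. (\<integral>\<^sup>+ z. c z \<partial>\<Gamma> n) < I + ennreal (inverse (real (Suc n)))"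
      by blast
    obtain \<Gamma>' H where \<Gamma>': "\<Gamma>' \<in> couplings \<mu> \<nu>" "H \<noteq> bot" "H \<le> sequentially"
      "\<And>E. E \<in> rect_ring \<Longrightarrow> ((\<lambda>n. measure (\<Gamma> n) E) \<longlongrightarrow> measure \<Gamma>' E) H"
      by (rule coupling_cluster[where \<Gamma> = \<Gamma>, OF \<mu> \<nu> \<Gamma>(1)]) blast
    have "(\<integral>\<^sup>+ z. c z \<partial>\<Gamma>') \<le> I + ennreal e" if "e > 0" for e :: real
    proof (rule lsc_cost_cluster[OF c \<Gamma>'(1) \<Gamma>(1) \<Gamma>'(2) \<Gamma>'(4)])
      have "eventually (\<lambda>n. inverse (real (Suc n)) < e) sequentially"
        using order_tendstoD(2)[OF LIMSEQ_inverse_real_of_nat \<open>e > 0\<close>] .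
      then have "eventually (\<lambda>n. (\<integral>\<^sup>+ z. c z \<partial>\<Gamma> n) \<le> I + ennreal e) sequentially"
      proof eventually_elim
        case (elim n)
        then have "I + ennreal (inverse (real (Suc n))) \<le> I + ennreal e"
          by (intro add_left_mono ennreal_leI) simp
        then show ?case using \<Gamma>(2)[of n] by (rule order_trans[OF less_imp_le, rotated])
      qed
      then show "eventually (\<lambda>n. (\<integral>\<^sup>+ z. c z \<partial>\<Gamma> n) \<le> I + ennreal e) H"
        using \<Gamma>'(3) by (rule filter_leD[rotated])
    qed
    then have "(\<integral>\<^sup>+ z. c z \<partial>\<Gamma>') \<le> I"
      by - (rule ennreal_le_epsilon)
    then have "(\<integral>\<^sup>+ z. c z \<partial>\<Gamma>') = I"
      using I_le[OF \<Gamma>'(1)] by (rule antisym)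
    then show ?thesis
      unfolding I_def by (rule that[OF \<Gamma>'(1)])
  qed
qed

section \<open>Monotonicity of the support of an optimal coupling\<close>

text \<open>Otherwise, exchanging the second components of the mass near \<open>(x, y)\<close> and near \<open>(x', y')\<close>
  would give a cheaper coupling.\<close>

lemma optimal_coupling_monotone:
  fixes k :: "'b::second_countable_topology \<times> 'b \<Rightarrow> real"
  assumes k: "continuous_on UNIV k" "\<And>z. 0 \<le> k z"
    and \<mu>: "\<mu> \<in> borel_probs" and \<nu>: "\<nu> \<in> borel_probs" and \<Gamma>: "\<Gamma> \<in> couplings \<mu> \<nu>"
    and opt: "\<And>\<Gamma>'. \<Gamma>' \<in> couplings \<mu> \<nu> \<Longrightarrow> (\<integral>\<^sup>+ z. k z \<partial>\<Gamma>) \<le> (\<integral>\<^sup>+ z. k z \<partial>\<Gamma>')"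
    and fin: "(\<integral>\<^sup>+ z. k z \<partial>\<Gamma>) < \<infinity>"
    and supp: "\<And>U. open U \<Longrightarrow> (x, y) \<in> U \<Longrightarrow> emeasure \<Gamma> U > 0"
    and supp': "\<And>U. open U \<Longrightarrow> (x', y') \<in> U \<Longrightarrow> emeasure \<Gamma> U > 0"
  shows "k (x, y) + k (x', y') \<le> k (x, y') + k (x', y)"
proof (rule ccontr)
  assume neg: "\<not> ?thesis"
  \<comment> \<open>One fifth of the supposed gain: four errors of size \<open>e\<close> still leave
    \<open>u0 + u1 < l0 + l1\<close>.\<close>
  define e where "e = (k (x, y) + k (x', y') - k (x, y') - k (x', y)) / 5"
  have e: "e > 0" using neg by (simp add: e_def)
  \<comment> \<open>Truncation at 0 makes the lower bounds usable in \<open>ennreal\<close>; they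
    stay below the cost because the cost is nonnegative.\<close>
  define l0 where "l0 = max 0 (k (x, y) - e)"
  define l1 where "l1 = max 0 (k (x', y') - e)"
  define u0 where "u0 = k (x, y') + e"
  define u1 where "u1 = k (x', y) + e"
  have "5 * e = k (x, y) + k (x', y') - k (x, y') - k (x', y)" by (simp add: e_def)
  moreover have "k (x, y) - e \<le> l0" "k (x', y') - e \<le> l1" by (simp_all add: l0_def l1_def)
  ultimately have "u0 + u1 < l0 + l1" using e unfolding u0_def u1_def by linarith
  moreover have "0 \<le> l0" "0 \<le> l1" "0 \<le> u0" "0 \<le> u1"
    using e k(2) by (simp_all add: l0_def l1_def u0_def u1_def add_nonneg_nonneg)
  ultimately have lu: "u0 + u1 < l0 + l1" "0 \<le> l0" "0 \<le> l1" "0 \<le> u0" "0 \<le> u1" by auto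
  have op: "open {z. k z > t}" "open {z. k z < t}" for t
    using k(1) by (auto intro!: open_Collect_less continuous_intros)
  obtain A1 B1 where 1: "open A1" "open B1" "(x, y) \<in> A1 \<times> B1" "A1 \<times> B1 \<subseteq> {z. k z > k (x, y) - e}"
    by (rule open_prod_elim[OF op(1), of "(x, y)" "k (x, y) - e"]) (use e in auto)
  obtain A2 B2 where 2: "open A2" "open B2" "(x', y') \<in> A2 \<times> B2" "A2 \<times> B2 \<subseteq> {z. k z > k (x', y') - e}"
    by (rule open_prod_elim[OF op(1), of "(x', y')" "k (x', y') - e"]) (use e in auto)
  obtain A3 B3 where 3: "open A3" "open B3" "(x, y') \<in> A3 \<times> B3" "A3 \<times> B3 \<subseteq> {z. k z < u0}"
    by (rule open_prod_elim[OF op(2), of "(x, y')" u0]) (use e in \<open>auto simp: u0_def\<close>)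
  obtain A4 B4 where 4: "open A4" "open B4" "(x', y) \<in> A4 \<times> B4" "A4 \<times> B4 \<subseteq> {z. k z < u1}"
    by (rule open_prod_elim[OF op(2), of "(x', y)" u1]) (use e in \<open>auto simp: u1_def\<close>)
  \<comment> \<open>The factors are intersected crosswise, so that for \<open>z\<close> in
    \<open>U\<close> and \<open>z'\<close> in \<open>V\<close> the exchanged pairs fall into
    \<open>A3 \<times> B3\<close> and \<open>A4 \<times> B4\<close>, where the upper bounds
    hold.\<close>
  define U where "U = (A1 \<inter> A3) \<times> (B1 \<inter> B4)"
  define V where "V = (A2 \<inter> A4) \<times> (B2 \<inter> B3)"
  have UV: "open U" "open V" "(x, y) \<in> U" "(x', y') \<in> V"
    using 1 2 3 4 by (auto simp: U_def V_def intro!: open_Times)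
  have kU: "l0 \<le> k z" if "z \<in> U" for z using that 1(4) k(2)[of z] by (force simp: U_def l0_def)
  have kV: "l1 \<le> k z" if "z \<in> V" for z using that 2(4) k(2)[of z] by (force simp: V_def l1_def)
  have kUV: "k (fst z, snd z') \<le> u0" "k (fst z', snd z) \<le> u1" if "z \<in> U" "z' \<in> V" for z z'
    using that 3(4) 4(4) by (force simp: U_def V_def)+
  note D = couplingsD[OF \<Gamma>]
  interpret prob_space \<Gamma> by (rule D)
  have [measurable_cong]: "sets \<Gamma> = sets borel" by (rule D)
  have [measurable]: "U \<in> sets borel" "V \<in> sets borel" using UV by auto
  have [measurable]: "k \<in> borel_measurable borel" using k(1) by (rule borel_measurable_continuous_onI)
  define a where "a = prob U"
  define b where "b = prob V"
  have a: "emeasure \<Gamma> U = ennreal a" "0 < a" "a \<le> 1"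
    using supp[OF UV(1,3)] by (auto simp: a_def emeasure_eq_measure)
  have b: "emeasure \<Gamma> V = ennreal b" "0 < b" "b \<le> 1"
    using supp'[OF UV(2,4)] by (auto simp: b_def emeasure_eq_measure)
  \<comment> \<open>The mass to be removed is \<open>\<Gamma>\<close> on \<open>U\<close> weighted
    by the mass \<open>b\<close> of \<open>V\<close>, and \<open>\<Gamma>\<close> on
    \<open>V\<close> weighted by the mass \<open>a\<close> of \<open>U\<close>: these are the
    marginals of the product of the two restrictions. As \<open>U\<close> and \<open>V\<close> may
    overlap and \<open>a\<close>, \<open>b\<close> are at most 1, the factor 1/2 keeps
    \<open>w\<close> below 1.\<close>
  define h :: real where "h = 1/2"
  have h: "0 < h" by (simp add: h_def)
  define w :: "'b \<times> 'b \<Rightarrow> real" where "w z = h * (b * indicator U z + a * indicator V z)" for z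
  have w: "0 \<le> w z" "w z \<le> 1" for z using a b by (auto simp: w_def h_def indicator_def)
  have [measurable]: "w \<in> borel_measurable borel" unfolding w_def by measurable
  define R where "R = density \<Gamma> (\<lambda>z. ennreal (1 - w z))"
  define UV where "UV = density (\<Gamma> \<Otimes>\<^sub>M \<Gamma>) (\<lambda>z. indicator U (fst z) * indicator V (snd z))"
  have [measurable_cong]: "sets UV = sets (borel \<Otimes>\<^sub>M borel)"
    unfolding UV_def by (simp cong: sets_pair_measure_cong add: D(2))
  have [measurable]: "(\<lambda>z::('b \<times> 'b) \<times> 'b \<times> 'b. (fst (fst z), snd (snd z))) \<in> borel \<Otimes>\<^sub>M borel \<rightarrow>\<^sub>M borel"
    "(\<lambda>z::('b \<times> 'b) \<times> 'b \<times> 'b. (fst (snd z), snd (fst z))) \<in> borel \<Otimes>\<^sub>M borel \<rightarrow>\<^sub>M borel"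
    by (simp_all add: borel_prod[symmetric])
  \<comment> \<open>Drawing \<open>z\<close> from \<open>U\<close> and \<open>z'\<close> from
    \<open>V\<close> independently, \<open>P\<close> and \<open>Q\<close> are the laws of the two
    exchanged pairs. Together they restore, up to the factor \<open>h\<close>, both marginals of the
    removed mass.\<close>
  define P where "P = distr UV borel (\<lambda>z. (fst (fst z), snd (snd z)))"
  define Q where "Q = distr UV borel (\<lambda>z. (fst (snd z), snd (fst z)))"
  have UV_int: "(\<integral>\<^sup>+ z. f z \<partial>UV) = (\<integral>\<^sup>+ z. indicator U z * (\<integral>\<^sup>+ z'. indicator V z' * f (z, z') \<partial>\<Gamma>) \<partial>\<Gamma>)"
    if [measurable]: "f \<in> borel_measurable (borel \<Otimes>\<^sub>M borel)" for f
  proof -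
    have "(\<integral>\<^sup>+ z. f z \<partial>UV) = (\<integral>\<^sup>+ z. indicator U (fst z) * indicator V (snd z) * f z \<partial>(\<Gamma> \<Otimes>\<^sub>M \<Gamma>))"
      unfolding UV_def by (subst nn_integral_density) auto
    also have "\<dots> = (\<integral>\<^sup>+ z. (\<integral>\<^sup>+ z'. indicator U z * indicator V z' * f (z, z') \<partial>\<Gamma>) \<partial>\<Gamma>)"
      using nn_integral_fst[of "\<lambda>z. indicator U (fst z) * indicator V (snd z) * f z" \<Gamma>] by simp
    also have "\<dots> = (\<integral>\<^sup>+ z. indicator U z * (\<integral>\<^sup>+ z'. indicator V z' * f (z, z') \<partial>\<Gamma>) \<partial>\<Gamma>)"
      by (intro nn_integral_cong) (simp add: nn_integral_cmult[symmetric] mult.assoc)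
    finally show ?thesis .
  qed
  have R_int: "(\<integral>\<^sup>+ z. f z \<partial>\<Gamma>) = (\<integral>\<^sup>+ z. f z \<partial>R)
      + ennreal h * (b * (\<integral>\<^sup>+ z. indicator U z * f z \<partial>\<Gamma>) + a * (\<integral>\<^sup>+ z. indicator V z * f z \<partial>\<Gamma>))"
    if [measurable]: "f \<in> borel_measurable borel" for f
  proof -
    have "(\<integral>\<^sup>+ z. f z \<partial>\<Gamma>) = (\<integral>\<^sup>+ z. ennreal (1 - w z) * f z + ennreal (w z) * f z \<partial>\<Gamma>)"
      using w by (intro nn_integral_cong) (simp flip: distrib_right ennreal_plus)
    also have "\<dots> = (\<integral>\<^sup>+ z. f z \<partial>R) + (\<integral>\<^sup>+ z. ennreal (w z) * f z \<partial>\<Gamma>)"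
      unfolding R_def by (subst nn_integral_add) (auto simp: nn_integral_density)
    also have "(\<integral>\<^sup>+ z. ennreal (w z) * f z \<partial>\<Gamma>)
        = (\<integral>\<^sup>+ z. ennreal h * (b * (indicator U z * f z) + a * (indicator V z * f z)) \<partial>\<Gamma>)"
    proof (rule nn_integral_cong)
      fix z
      have "ennreal (w z) = ennreal h * (ennreal b * indicator U z + ennreal a * indicator V z)"
        using a b h by (auto simp: w_def indicator_def simp flip: ennreal_mult ennreal_plus)
      then show "ennreal (w z) * f z = ennreal h * (b * (indicator U z * f z) + a * (indicator V z * f z))"
        by (simp add: distrib_right mult.assoc)
    qed
    also have "\<dots> = ennreal h * (b * (\<integral>\<^sup>+ z. indicator U z * f z \<partial>\<Gamma>) + a * (\<integral>\<^sup>+ z. indicator V z * f z \<partial>\<Gamma>))"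
      by (simp add: nn_integral_cmult nn_integral_add)
    finally show ?thesis .
  qed
  define \<Gamma>' where "\<Gamma>' = add_measure R (scale_measure (ennreal h) (add_measure P Q))"
  have sts: "sets R = sets borel" "sets P = sets borel" "sets Q = sets borel"
    by (auto simp: R_def P_def Q_def D(2))
  have \<Gamma>'_int: "(\<integral>\<^sup>+ z. f z \<partial>\<Gamma>') = (\<integral>\<^sup>+ z. f z \<partial>R) + ennreal h * ((\<integral>\<^sup>+ z. f z \<partial>P) + (\<integral>\<^sup>+ z. f z \<partial>Q))"
    if f: "f \<in> borel_measurable borel" for f
  proof -
    have "f \<in> borel_measurable R" "f \<in> borel_measurable P"
      using f sts by (simp_all cong: measurable_cong_sets)
    then show ?thesis
      unfolding \<Gamma>'_def using sts
      by (simp add: nn_integral_add_measure nn_integral_scale_measure cong: measurable_cong_sets)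
  qed
  have P_int: "(\<integral>\<^sup>+ z. f z \<partial>P) = (\<integral>\<^sup>+ z. indicator U z * (\<integral>\<^sup>+ z'. indicator V z' * f (fst z, snd z') \<partial>\<Gamma>) \<partial>\<Gamma>)"
    and Q_int: "(\<integral>\<^sup>+ z. f z \<partial>Q) = (\<integral>\<^sup>+ z. indicator U z * (\<integral>\<^sup>+ z'. indicator V z' * f (fst z', snd z) \<partial>\<Gamma>) \<partial>\<Gamma>)"
    if [measurable]: "f \<in> borel_measurable borel" for f
    unfolding P_def Q_def by (subst nn_integral_distr; simp add: UV_int)+
  have prj [measurable]: "(fst :: 'b \<times> 'b \<Rightarrow> 'b) \<in> borel_measurable borel" "(snd :: 'b \<times> 'b \<Rightarrow> 'b) \<in> borel_measurable borel"
    by (simp_all add: borel_prod[symmetric])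
  have "\<Gamma>' \<in> couplings \<mu> \<nu>"
  proof (rule couplingsI[OF _ \<mu> \<nu>])
    show "sets \<Gamma>' = sets borel" by (simp add: \<Gamma>'_def sts)
  next
    fix A :: "'b set" assume [measurable]: "A \<in> sets borel"
    define f where "f z = (indicator A (fst z) :: ennreal)" for z :: "'b \<times> 'b"
    have [measurable]: "f \<in> borel_measurable borel" unfolding f_def by measurable
    have f: "f (fst z, t) = f z" for z t by (simp add: f_def)
    have PI: "(\<integral>\<^sup>+ z. f z \<partial>P) = b * (\<integral>\<^sup>+ z. indicator U z * f z \<partial>\<Gamma>)"
    proof -
      have "(\<integral>\<^sup>+ z. f z \<partial>P) = (\<integral>\<^sup>+ z. ennreal b * (indicator U z * f z) \<partial>\<Gamma>)"
        by (simp add: P_int f nn_integral_multc b) (simp add: mult_ac)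
      also have "\<dots> = b * (\<integral>\<^sup>+ z. indicator U z * f z \<partial>\<Gamma>)"
        by (rule nn_integral_cmult) measurable
      finally show ?thesis .
    qed
    have QI: "(\<integral>\<^sup>+ z. f z \<partial>Q) = a * (\<integral>\<^sup>+ z. indicator V z * f z \<partial>\<Gamma>)"
      by (simp add: Q_int f nn_integral_multc a)
    have "(\<integral>\<^sup>+ z. f z \<partial>\<Gamma>') = (\<integral>\<^sup>+ z. f z \<partial>\<Gamma>)"
      by (simp add: \<Gamma>'_int R_int[of f] PI QI)
    moreover have "f = indicator (A \<times> UNIV)" by (auto simp: f_def indicator_def fun_eq_iff mem_Times_iff)
    moreover have "A \<times> UNIV \<in> sets (borel :: ('b \<times> 'b) measure)"
      by (simp add: rect_ring_borel Times_in_rect_ring)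
    ultimately show "emeasure \<Gamma>' (A \<times> UNIV) = emeasure \<mu> A"
      using emeasure_coupling_fst[OF \<Gamma>, of A] by (simp add: D(2) \<Gamma>'_def sts)
  next
    fix A :: "'b set" assume [measurable]: "A \<in> sets borel"
    define f where "f z = (indicator A (snd z) :: ennreal)" for z :: "'b \<times> 'b"
    have [measurable]: "f \<in> borel_measurable borel" unfolding f_def by measurable
    have f: "f (t, snd z) = f z" for z t by (simp add: f_def)
    have PI: "(\<integral>\<^sup>+ z. f z \<partial>P) = a * (\<integral>\<^sup>+ z. indicator V z * f z \<partial>\<Gamma>)"
      by (simp add: P_int f nn_integral_multc a)
    have QI: "(\<integral>\<^sup>+ z. f z \<partial>Q) = b * (\<integral>\<^sup>+ z. indicator U z * f z \<partial>\<Gamma>)"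
    proof -
      have "(\<integral>\<^sup>+ z. f z \<partial>Q) = (\<integral>\<^sup>+ z. ennreal b * (indicator U z * f z) \<partial>\<Gamma>)"
        by (simp add: Q_int f nn_integral_multc b) (simp add: mult_ac)
      also have "\<dots> = b * (\<integral>\<^sup>+ z. indicator U z * f z \<partial>\<Gamma>)"
        by (rule nn_integral_cmult) measurable
      finally show ?thesis .
    qed
    have "(\<integral>\<^sup>+ z. f z \<partial>\<Gamma>') = (\<integral>\<^sup>+ z. f z \<partial>\<Gamma>)"
      by (simp add: \<Gamma>'_int R_int[of f] PI QI add.commute)
    moreover have "f = indicator (UNIV \<times> A)" by (auto simp: f_def indicator_def fun_eq_iff mem_Times_iff)
    moreover have "UNIV \<times> A \<in> sets (borel :: ('b \<times> 'b) measure)"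
      by (simp add: rect_ring_borel Times_in_rect_ring)
    ultimately show "emeasure \<Gamma>' (UNIV \<times> A) = emeasure \<nu> A"
      using emeasure_coupling_snd[OF \<Gamma>, of A] by (simp add: D(2) \<Gamma>'_def sts)
  qed
  from opt[OF this]
  have "(\<integral>\<^sup>+ z. k z \<partial>R) + ennreal h * (b * (\<integral>\<^sup>+ z. indicator U z * ennreal (k z) \<partial>\<Gamma>) + a * (\<integral>\<^sup>+ z. indicator V z * ennreal (k z) \<partial>\<Gamma>))
    \<le> (\<integral>\<^sup>+ z. k z \<partial>R) + ennreal h * ((\<integral>\<^sup>+ z. k z \<partial>P) + (\<integral>\<^sup>+ z. k z \<partial>Q))"
    by (simp add: \<Gamma>'_int R_int[of "\<lambda>z. ennreal (k z)"])
  \<comment> \<open>The untouched part \<open>R\<close> can be cancelled only because its cost is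
    finite.\<close>
  moreover have "(\<integral>\<^sup>+ z. k z \<partial>R) \<noteq> \<top>"
  proof -
    have "(\<integral>\<^sup>+ z. k z \<partial>R) \<le> (\<integral>\<^sup>+ z. k z \<partial>\<Gamma>)"
      using R_int[of "\<lambda>z. ennreal (k z)"] by simp
    then show ?thesis using fin by (auto simp: top_unique)
  qed
  ultimately have "ennreal h * (b * (\<integral>\<^sup>+ z. indicator U z * ennreal (k z) \<partial>\<Gamma>) + a * (\<integral>\<^sup>+ z. indicator V z * ennreal (k z) \<partial>\<Gamma>))
    \<le> ennreal h * ((\<integral>\<^sup>+ z. k z \<partial>P) + (\<integral>\<^sup>+ z. k z \<partial>Q))" (is "?l \<le> ?r")
    by (simp add: ennreal_add_left_cancel_le)
  \<comment> \<open>The removed mass costs at least \<open>h * a * b * (l0 + l1)\<close>, the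
    inserted mass at most \<open>h * a * b * (u0 + u1)\<close>; optimality then contradicts
    \<open>u0 + u1 < l0 + l1\<close>.\<close>
  moreover have "ennreal h * (b * (l0 * a) + a * (l1 * b)) \<le> ?l"
  proof -
    have "ennreal l0 * a = (\<integral>\<^sup>+ z. ennreal l0 * indicator U z \<partial>\<Gamma>)"
      by (simp add: nn_integral_cmult a)
    also have "\<dots> \<le> (\<integral>\<^sup>+ z. indicator U z * ennreal (k z) \<partial>\<Gamma>)"
      using kU by (intro nn_integral_mono) (auto simp: indicator_def intro: ennreal_leI)
    finally have 1: "ennreal l0 * a \<le> (\<integral>\<^sup>+ z. indicator U z * ennreal (k z) \<partial>\<Gamma>)" .
    have "ennreal l1 * b = (\<integral>\<^sup>+ z. ennreal l1 * indicator V z \<partial>\<Gamma>)"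
      by (simp add: nn_integral_cmult b)
    also have "\<dots> \<le> (\<integral>\<^sup>+ z. indicator V z * ennreal (k z) \<partial>\<Gamma>)"
      using kV by (intro nn_integral_mono) (auto simp: indicator_def intro: ennreal_leI)
    finally have 2: "ennreal l1 * b \<le> (\<integral>\<^sup>+ z. indicator V z * ennreal (k z) \<partial>\<Gamma>)" .
    have "ennreal h * (b * (l0 * a) + a * (l1 * b))
        = ennreal h * (ennreal b * (ennreal l0 * ennreal a) + ennreal a * (ennreal l1 * ennreal b))"
      using a b lu h by (simp flip: ennreal_mult ennreal_plus)
    also have "\<dots> \<le> ?l" using 1 2 by (intro mult_left_mono add_mono) auto
    finally show ?thesis .
  qed
  moreover have "?r \<le> ennreal h * (u0 * b * a + u1 * b * a)"
  proof -
    have *: "(\<integral>\<^sup>+ z. indicator U z * (\<integral>\<^sup>+ z'. indicator V z' * g z z' \<partial>\<Gamma>) \<partial>\<Gamma>) \<le> ennreal (u * b * a)"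
      if "\<And>z z'. z \<in> U \<Longrightarrow> z' \<in> V \<Longrightarrow> g z z' \<le> ennreal u" "0 \<le> u" for g u
    proof -
      have "(\<integral>\<^sup>+ z. indicator U z * (\<integral>\<^sup>+ z'. indicator V z' * g z z' \<partial>\<Gamma>) \<partial>\<Gamma>)
          \<le> (\<integral>\<^sup>+ z. indicator U z * (\<integral>\<^sup>+ z'. indicator V z' * ennreal u \<partial>\<Gamma>) \<partial>\<Gamma>)"
        using that by (intro nn_integral_mono) (auto simp: indicator_def intro!: nn_integral_mono)
      also have "\<dots> = ennreal (u * b * a)"
        using that(2) a b by (simp add: nn_integral_multc) (simp add: mult_ac flip: ennreal_mult)
      finally show ?thesis .
    qed
    have "(\<integral>\<^sup>+ z. k z \<partial>P) \<le> ennreal (u0 * b * a)" "(\<integral>\<^sup>+ z. k z \<partial>Q) \<le> ennreal (u1 * b * a)"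
      using kUV lu by (auto simp: P_int Q_int intro!: * ennreal_leI)
    then show ?thesis
      using a b lu by (intro mult_left_mono) (auto intro: add_mono)
  qed
  ultimately have "ennreal h * (b * (l0 * a) + a * (l1 * b)) \<le> ennreal h * (u0 * b * a + u1 * b * a)"
    by (meson order_trans)
  then have "h * (b * (l0 * a) + a * (l1 * b)) \<le> h * (u0 * b * a + u1 * b * a)"
    using a b lu h by (simp flip: ennreal_mult ennreal_plus)
  then have "(h * a * b) * (l0 + l1) \<le> (h * a * b) * (u0 + u1)"
    by (simp add: algebra_simps)
  then show False using a b h lu(1) by simp
qed

section \<open>Multivalued points of a monotone set\<close>

lemma powr_tangent_le:
  fixes p r s :: real
  assumes "p > 1" "0 \<le> r" "0 \<le> s"
  shows "s powr p + p * s powr (p - 1) * (r - s) \<le> r powr p"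
\<comment> \<open>The tangent argument needs a point inside the open half-line. On the boundary,
  \<open>r = 0\<close> leaves \<open>s powr p \<le> p * s powr p\<close>, and \<open>s = 0\<close>
  leaves \<open>0 \<le> r powr p\<close>, as powers of 0 are 0.\<close>
proof (cases "s = 0 \<or> r = 0")
  case True
  have "s powr p = s powr (p - 1) * s" if "s \<noteq> 0"
    using that assms powr_mult_base[of s "p - 1"] by (simp add: mult.commute)
  moreover have "s powr (p - 1) * s \<le> p * (s powr (p - 1) * s)"
    using assms mult_right_mono[of 1 p "s powr (p - 1) * s"] by simp
  ultimately show ?thesis using True assms by (cases "s = 0") (auto simp: mult.assoc)
next
  case False
  then have rs: "r > 0" "s > 0" using assms by auto
  have "r powr p - s powr p \<ge> (p * s powr (p - 1)) * (r - s)"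
  proof (rule convex_on_imp_above_tangent[where A = "{0<..}" and f = "\<lambda>x. x powr p"])
    show "convex_on {0<..} (\<lambda>x. x powr p)" using assms by (intro powr_convex) simp
    show "((\<lambda>x. x powr p) has_field_derivative p * s powr (p - 1)) (at s within {0<..})"
      using rs by (auto intro!: derivative_eq_intros)
  qed (use rs in \<open>auto simp: interior_open\<close>)
  then show ?thesis by simp
qed

text \<open>The gradient of \<open>norm z powr p / p\<close>.\<close>

definition powr_grad :: "real \<Rightarrow> 'a::real_normed_vector \<Rightarrow> 'a" where
  "powr_grad p z = norm z powr (p - 2) *\<^sub>R z"

lemma norm_powr_grad: "p > 1 \<Longrightarrow> norm (powr_grad p z) = norm z powr (p - 1)"
  using powr_mult_base[of "norm z" "p - 2"] by (cases "z = 0") (simp_all add: powr_grad_def mult.commute)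

text \<open>The Cauchy-Schwarz inequality reduces this to the tangent inequality for the
  norms.\<close>

lemma powr_grad_subgradient:
  fixes a b :: "'a::real_inner"
  assumes "p > 1"
  shows "norm a powr p + p * (powr_grad p a \<bullet> (b - a)) \<le> norm b powr p"
proof -
  have "powr_grad p a \<bullet> b \<le> norm (powr_grad p a) * norm b" by (rule norm_cauchy_schwarz)
  moreover have "powr_grad p a \<bullet> a = norm (powr_grad p a) * norm a"
    by (simp add: powr_grad_def dot_square_norm power2_eq_square)
  ultimately have "powr_grad p a \<bullet> (b - a) \<le> norm a powr (p - 1) * (norm b - norm a)"
    using assms by (simp add: inner_diff_right right_diff_distrib norm_powr_grad)
  then have "p * (powr_grad p a \<bullet> (b - a)) \<le> p * (norm a powr (p - 1) * (norm b - norm a))"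
    using assms by (intro mult_left_mono) auto
  with powr_tangent_le[OF assms, of "norm b" "norm a"] show ?thesis by (simp add: mult.assoc)
qed

text \<open>Strict convexity in the form used below: since \<open>p - 1 > 0\<close>, the norm of the
  gradient determines the norm of the vector, and then the scaling factor can be divided
  out.\<close>

lemma powr_grad_inj:
  fixes a b :: "'a::real_normed_vector"
  assumes "p > 1" "powr_grad p a = powr_grad p b"
  shows "a = b"
proof -
  have "norm a powr (p - 1) = norm b powr (p - 1)"
    using assms by (metis norm_powr_grad)
  moreover have "norm z = (norm z powr (p - 1)) powr (1 / (p - 1))" for z :: 'a
    using assms(1) by (simp add: powr_powr)
  ultimately have n: "norm a = norm b"
    by metis
  show ?thesis
  proof (cases "a = 0")
    case False
    then have "b \<noteq> 0" using n by auto
    with False show ?thesis using assms(2) n by (simp add: powr_grad_def)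
  qed (use n in simp)
qed

lemma isCont_powr_grad:
  assumes "p > 1"
  shows "isCont (powr_grad p) a"
proof (cases "a = 0")
  case True
  \<comment> \<open>For \<open>p < 2\<close> the factor \<open>norm z powr (p - 2)\<close> blows up
    at 0, but the norm of the whole vector is \<open>norm z powr (p - 1)\<close> and tends to
    0.\<close>
  have "((\<lambda>z. norm (powr_grad p z)) \<longlongrightarrow> 0) (at 0)"
    unfolding norm_powr_grad[OF assms]
    using assms by (auto intro!: tendsto_eq_intros tendsto_norm_zero)
  then show ?thesis
    using True by (auto simp: isCont_def powr_grad_def intro: tendsto_norm_zero_cancel)
next
  case False
  then show ?thesis
    unfolding powr_grad_def[abs_def] by (intro continuous_intros) auto
qed

section \<open>Null sets from disjoint translates\<close>

text \<open>Infinitely many translates of such a set are disjoint inside a bounded region.\<close>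

lemma negligible_no_translates:
  fixes N :: "'a::euclidean_space set"
  assumes N: "compact N" and no: "\<And>y t. y \<in> N \<Longrightarrow> y + t *\<^sub>R e \<in> N \<Longrightarrow> t > 0 \<Longrightarrow> False"
  shows "negligible N"
proof -
  define v where "v n = inverse (real (Suc n)) *\<^sub>R e" for n
  define A where "A n = (+) (v n) ` N" for n
  have cA: "compact (A n)" for n using N by (simp add: A_def compact_translation)
  have sA: "range A \<subseteq> sets lebesgue" using cA lmeasurable_compact by blast
  have aux: "m = n" if "y \<in> N" "y' \<in> N" "v m + y = v n + y'" for m n y y'
  proof (rule ccontr)
    assume "m \<noteq> n"
    define t where "t = inverse (real (Suc m)) - inverse (real (Suc n))"
    have "t \<noteq> 0" using \<open>m \<noteq> n\<close> by (simp add: t_def)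
    have "y' = y + t *\<^sub>R e" "y = y' + (- t) *\<^sub>R e"
      using that(3) by (auto simp: v_def t_def algebra_simps)
    then show False using no[of y t] no[of y' "- t"] that \<open>t \<noteq> 0\<close> by (cases "t > 0") auto
  qed
  have "disjoint_family A"
    unfolding disjoint_family_on_def A_def using aux by blast
  moreover have "emeasure lebesgue (\<Union>n. A n) \<noteq> \<infinity>"
  proof -
    obtain B where B: "\<And>y. y \<in> N \<Longrightarrow> norm y \<le> B"
      using compact_imp_bounded[OF N] unfolding bounded_iff by blast
    have "(\<Union>n. A n) \<subseteq> cball 0 (norm e + B)"
    proof
      fix z assume "z \<in> (\<Union>n. A n)"
      then obtain n y where "y \<in> N" "z = v n + y" by (auto simp: A_def)
      moreover have "norm (v n) \<le> norm e"
        unfolding v_def norm_scaleR by (rule mult_left_le_one_le) (auto simp: field_simps)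
      ultimately show "z \<in> cball 0 (norm e + B)" using B[of y] norm_triangle_ineq[of "v n" y] by simp
    qed
    then have "emeasure lebesgue (\<Union>n. A n) \<le> emeasure lebesgue (cball 0 (norm e + B) :: 'a set)"
      by (rule emeasure_mono) simp
    also have "\<dots> < \<infinity>" using emeasure_bounded_finite[OF bounded_cball] by simp
    finally show ?thesis by simp
  qed
  \<comment> \<open>All translates have the measure of \<open>N\<close>, and a constant series
    converges only if the constant is 0.\<close>
  ultimately have "summable (\<lambda>n. measure lebesgue (A n))"
    using measure_UNION[OF sA] by (auto simp: sums_iff)
  then have "measure lebesgue N = 0"
    by (simp add: A_def measure_translation summable_const_iff)
  then show ?thesis
    using N by (simp add: negligible_iff_measure0 lmeasurable_compact)
qed

text \<open>If \<open>y\<close> has partners \<open>x0\<close> and \<open>x1\<close>, the gradients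
  at \<open>y - x0\<close> and \<open>y - x1\<close> differ, and some signed basis vector
  \<open>e\<close> has positive inner product with their difference. Were \<open>y\<close> and
  \<open>y + t *\<^sub>R e\<close> in one small piece with \<open>t > 0\<close>, then
  \<open>y + t *\<^sub>R e\<close> with a partner near \<open>x0\<close> and \<open>y\<close> with a
  partner near \<open>x1\<close> would violate \<open>mono\<close>, by one subgradient inequality
  for each partner. Centres from a countable dense set and radii \<open>rd n\<close> leave countably
  many pieces.\<close>

lemma monotone_multivalued_negligible:
  fixes S :: "('b::euclidean_space \<times> 'b) set"
  assumes p: "p > 1" and S: "closed S"
    and mono: "\<And>x y x' y'. (x, y) \<in> S \<Longrightarrow> (x', y') \<in> S \<Longrightarrow>
      norm (x - y) powr p + norm (x' - y') powr p \<le> norm (x - y') powr p + norm (x' - y) powr p"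
  shows "negligible {y. \<exists>x x'. x \<noteq> x' \<and> (x, y) \<in> S \<and> (x', y) \<in> S}"
proof -
  obtain D :: "'b set" where D: "countable D" "\<And>X. open X \<Longrightarrow> X \<noteq> {} \<Longrightarrow> \<exists>d\<in>D. d \<in> X"
    by (rule countable_dense_setE) blast
  define rd where "rd n = inverse (real (Suc n))" for n
  define P where "P K = {y. \<exists>x. x \<in> K \<and> (x, y) \<in> S}" for K
  \<comment> \<open>The sign is required on whole balls, because the points of an exchange are known
    only up to the radius \<open>rd n\<close>.\<close>
  define good where "good = (\<lambda>(q0 :: 'b, q1, q, n, e). \<forall>x\<in>cball q0 (rd n). \<forall>x1\<in>cball q1 (rd n).
      \<forall>y\<in>cball q (rd n). \<forall>y'\<in>cball q (rd n). 0 < (powr_grad p (y - x) - powr_grad p (y' - x1)) \<bullet> e)"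
  define N where "N = (\<lambda>(q0, q1, q, n, e :: 'b). cball q (rd n) \<inter> (P (cball q0 (rd n)) \<inter> P (cball q1 (rd n))))"
  define T where "T = D \<times> D \<times> D \<times> (UNIV :: nat set) \<times> ((Basis :: 'b set) \<union> uminus ` Basis)"
  have "negligible (N \<tau>)" if good: "good \<tau>" for \<tau>
  proof -
    obtain q0 q1 q n e where \<tau>: "\<tau> = (q0, q1, q, n, e)" by (cases \<tau>) auto
    \<comment> \<open>Projecting a closed set along a compact factor keeps it closed, so the pieces
      are compact.\<close>
    have cl: "closed (P (cball q0 (rd n)))" "closed (P (cball q1 (rd n)))"
      unfolding P_def using S by (intro closed_compact_projection; simp)+
    show ?thesis
    proof (rule negligible_no_translates)
      show "compact (N \<tau>)"
        using cl unfolding \<tau> N_def by (auto intro: compact_Int_closed closed_Int)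
      fix y t assume y: "y \<in> N \<tau>" "y + t *\<^sub>R e \<in> N \<tau>" "t > 0"
      define y' where "y' = y + t *\<^sub>R e"
      obtain x where x: "x \<in> cball q0 (rd n)" "(x, y') \<in> S"
        using y(2) by (auto simp: N_def \<tau> P_def y'_def)
      obtain x1 where x1: "x1 \<in> cball q1 (rd n)" "(x1, y) \<in> S"
        using y(1) by (auto simp: N_def \<tau> P_def)
      have "y \<in> cball q (rd n)" "y' \<in> cball q (rd n)"
        using y by (auto simp: N_def \<tau> y'_def)
      then have pos: "0 < (powr_grad p (y - x) - powr_grad p (y' - x1)) \<bullet> e"
        using good x x1 unfolding \<tau> good_def by blast
      have "norm (y' - x) powr p + norm (y - x1) powr p \<le> norm (y - x) powr p + norm (y' - x1) powr p"
        using mono[OF x(2) x1(2)] by (simp add: norm_minus_commute)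
      moreover have "norm (y - x) powr p + p * (powr_grad p (y - x) \<bullet> (t *\<^sub>R e)) \<le> norm (y' - x) powr p"
        using powr_grad_subgradient[OF p, of "y - x" "y' - x"] by (simp add: y'_def)
      moreover have "norm (y' - x1) powr p + p * (powr_grad p (y' - x1) \<bullet> (- (t *\<^sub>R e))) \<le> norm (y - x1) powr p"
        using powr_grad_subgradient[OF p, of "y' - x1" "y - x1"] by (simp add: y'_def)
      ultimately have "p * t * ((powr_grad p (y - x) - powr_grad p (y' - x1)) \<bullet> e) \<le> 0"
        by (simp add: inner_diff_left algebra_simps)
      moreover have "0 < p * t * ((powr_grad p (y - x) - powr_grad p (y' - x1)) \<bullet> e)"
        using pos p y(3) by simp
      ultimately show False by simp
    qed
  qed
  moreover have "countable {\<tau> \<in> T. good \<tau>}"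
  proof (rule countable_subset)
    have "countable ((Basis :: 'b set) \<union> uminus ` Basis)" by (intro countable_finite) simp
    then show "countable T" using D(1) unfolding T_def by (intro countable_SIGMA) simp_all
  qed auto
  ultimately have "negligible (\<Union>(N ` {\<tau> \<in> T. good \<tau>}))"
    by (intro negligible_countable_Union) auto
  moreover have "{y. \<exists>x x'. x \<noteq> x' \<and> (x, y) \<in> S \<and> (x', y) \<in> S} \<subseteq> \<Union>(N ` {\<tau> \<in> T. good \<tau>})"
  proof clarify
    fix y x0 x1 assume x: "x0 \<noteq> x1" "(x0, y) \<in> S" "(x1, y) \<in> S"
    define G where "G = powr_grad p (y - x0) - powr_grad p (y - x1)"
    have "G \<noteq> 0" using powr_grad_inj[OF p, of "y - x0" "y - x1"] x(1) by (auto simp: G_def)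
    then obtain i where i: "i \<in> Basis" "G \<bullet> i \<noteq> 0" using euclidean_all_zero_iff by blast
    define e where "e = (if G \<bullet> i > 0 then i else - i)"
    have e: "e \<in> Basis \<union> uminus ` Basis" "G \<bullet> e > 0" "norm e = 1"
      using i by (auto simp: e_def)
    \<comment> \<open>Two gradients each move by less than a third of \<open>G \<bullet> e\<close>,
      so more than a third remains.\<close>
    have "G \<bullet> e / 3 > 0" using e by simp
    then obtain d0 where d0: "d0 > 0"
      "\<And>z. dist z (y - x0) < d0 \<Longrightarrow> dist (powr_grad p z) (powr_grad p (y - x0)) < G \<bullet> e / 3"
      using isCont_powr_grad[OF p, of "y - x0"] unfolding continuous_at_eps_delta by blast
    from \<open>G \<bullet> e / 3 > 0\<close> obtain d1 where d1: "d1 > 0"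
      "\<And>z. dist z (y - x1) < d1 \<Longrightarrow> dist (powr_grad p z) (powr_grad p (y - x1)) < G \<bullet> e / 3"
      using isCont_powr_grad[OF p, of "y - x1"] unfolding continuous_at_eps_delta by blast
    \<comment> \<open>A point and its partner each move by at most a diameter
      \<open>2 * rd n\<close>, so their difference moves by at most \<open>4 * rd n\<close>.\<close>
    have "min d0 d1 / 4 > 0" using d0(1) d1(1) by simp
    then obtain n where n: "rd n < min d0 d1 / 4"
      unfolding rd_def using reals_Archimedean by blast
    have "rd n > 0" by (simp add: rd_def)
    then have "\<exists>q\<in>D. z \<in> cball q (rd n)" for z
      using D(2)[of "ball z (rd n)"] by (auto simp: dist_commute intro: less_imp_le)
    then obtain q0 q1 q where q: "q0 \<in> D" "q1 \<in> D" "q \<in> D"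
      "x0 \<in> cball q0 (rd n)" "x1 \<in> cball q1 (rd n)" "y \<in> cball q (rd n)" by metis
    have "good (q0, q1, q, n, e)"
      unfolding good_def prod.case
    proof (intro ballI)
      fix a b z z' assume h: "a \<in> cball q0 (rd n)" "b \<in> cball q1 (rd n)" "z \<in> cball q (rd n)" "z' \<in> cball q (rd n)"
      have near: "dist (z - a) (y - x) < 4 * rd n + c"
        if "z \<in> cball q (rd n)" "a \<in> cball r (rd n)" "x \<in> cball r (rd n)" "c > 0" for z a x r c
      proof -
        have "dist z y \<le> 2 * rd n" "dist a x \<le> 2 * rd n"
          using that q(6) dist_triangle2[of z y q] dist_triangle2[of a x r] by (auto simp: dist_commute)
        moreover have "dist (z - a) (y - x) \<le> dist z y + dist a x"
          using norm_triangle_ineq4[of "z - y" "a - x"] by (simp add: dist_norm algebra_simps)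
        ultimately show ?thesis using that(4) by linarith
      qed
      have "dist (z - a) (y - x0) < d0"
        using near[OF h(3,1) q(4), of "d0 - 4 * rd n"] n by auto
      then have g0: "norm (powr_grad p (z - a) - powr_grad p (y - x0)) < G \<bullet> e / 3"
        using d0(2) by (simp add: dist_norm)
      have "dist (z' - b) (y - x1) < d1"
        using near[OF h(4,2) q(5), of "d1 - 4 * rd n"] n by auto
      then have g1: "norm (powr_grad p (z' - b) - powr_grad p (y - x1)) < G \<bullet> e / 3"
        using d1(2) by (simp add: dist_norm)
      have le: "\<bar>v \<bullet> e\<bar> \<le> norm v" for v
        using Cauchy_Schwarz_ineq2[of v e] e(3) by simp
      have "(powr_grad p (z - a) - powr_grad p (z' - b)) \<bullet> e = G \<bullet> e
          + (powr_grad p (z - a) - powr_grad p (y - x0)) \<bullet> e - (powr_grad p (z' - b) - powr_grad p (y - x1)) \<bullet> e"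
        by (simp add: G_def inner_diff_left)
      then show "0 < (powr_grad p (z - a) - powr_grad p (z' - b)) \<bullet> e"
        using g0 g1 le[of "powr_grad p (z - a) - powr_grad p (y - x0)"]
          le[of "powr_grad p (z' - b) - powr_grad p (y - x1)"] e(2) by linarith
    qed
    moreover have "y \<in> N (q0, q1, q, n, e)" using q x by (auto simp: N_def P_def)
    moreover have "(q0, q1, q, n, e) \<in> T" using q e by (auto simp: T_def)
    ultimately show "y \<in> \<Union>(N ` {\<tau> \<in> T. good \<tau>})" by blast
  qed
  ultimately show ?thesis by (rule negligible_subset)
qed

section \<open>Uniqueness of minimizers\<close>

definition measure_support :: "'a::topological_space measure \<Rightarrow> 'a set" where
  "measure_support M = {z. \<forall>U. open U \<longrightarrow> z \<in> U \<longrightarrow> emeasure M U > 0}"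

text \<open>The complement of the support is a union of null basic open sets, and second
  countability makes this union countable.\<close>

lemma
  fixes M :: "'a::second_countable_topology measure"
  assumes M: "sets M = sets borel"
  shows closed_measure_support: "closed (measure_support M)"
    and emeasure_Compl_support: "emeasure M (- measure_support M) = 0"
proof -
  obtain \<B> :: "'a set set" where \<B>: "countable \<B>" "topological_basis \<B>"
    using ex_countable_basis by blast
  have o: "open B" if "B \<in> \<B>" for B using topological_basis_open[OF \<B>(2) that] .
  have eq: "- measure_support M = \<Union>{B \<in> \<B>. emeasure M B = 0}"
  proof (intro equalityI subsetI)
    fix z assume "z \<in> - measure_support M"
    then obtain U where U: "open U" "z \<in> U" "emeasure M U = 0"
      by (auto simp: measure_support_def zero_less_iff_neq_zero)
    obtain B where B: "B \<in> \<B>" "z \<in> B" "B \<subseteq> U" using topological_basisE[OF \<B>(2) U(1,2)] .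
    have "emeasure M B \<le> emeasure M U" using B U M by (intro emeasure_mono) auto
    then show "z \<in> \<Union>{B \<in> \<B>. emeasure M B = 0}" using B U by auto
  next
    fix z assume "z \<in> \<Union>{B \<in> \<B>. emeasure M B = 0}"
    then obtain B where "B \<in> \<B>" "z \<in> B" "emeasure M B = 0" by auto
    then show "z \<in> - measure_support M"
      using o[of B] by (auto simp: measure_support_def zero_less_iff_neq_zero)
  qed
  have "open (- measure_support M)" unfolding eq using o by auto
  then show "closed (measure_support M)" by (simp add: open_closed)
  have "(\<Union>B\<in>{B \<in> \<B>. emeasure M B = 0}. B) \<in> null_sets M"
  proof (rule null_sets_UN')
    show "countable {B \<in> \<B>. emeasure M B = 0}" using \<B>(1) by auto
    show "B \<in> null_sets M" if "B \<in> {B \<in> \<B>. emeasure M B = 0}" for B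
      using that o M by (auto simp: null_sets_def)
  qed
  then show "emeasure M (- measure_support M) = 0" unfolding eq by (simp add: null_sets_def)
qed

text \<open>On a set of full measure, \<open>S\<close> is the graph of a function of the second component.\<close>

lemma coupling_fst_marginal_eq:
  fixes S :: "('b::euclidean_space \<times> 'b) set"
  assumes \<Gamma>: "\<Gamma> \<in> couplings \<mu> \<nu>" and ac: "absolutely_continuous lborel \<nu>"
    and S: "closed S" "emeasure \<Gamma> (- S) = 0"
    and Z: "negligible {y. \<exists>x x'. x \<noteq> x' \<and> (x, y) \<in> S \<and> (x', y) \<in> S}"
    and K: "compact K"
  shows "emeasure \<mu> K = emeasure \<nu> {y. \<exists>x. x \<in> K \<and> (x, y) \<in> S}"
proof -
  let ?P = "{y. \<exists>x. x \<in> K \<and> (x, y) \<in> S}"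
  note D = couplingsD[OF \<Gamma>]
  \<comment> \<open>Compactness of \<open>K\<close> makes the projection closed; for a general Borel
    set its measurability would be unclear.\<close>
  have bP: "?P \<in> sets borel" using closed_compact_projection[OF K S(1)] by simp
  have bK: "K \<in> sets borel" using K by (simp add: borel_compact)
  \<comment> \<open>\<open>negligible\<close> refers to the completed measure; a Borel null superset
    is chosen so that \<open>ac\<close> applies.\<close>
  obtain Z' where Z': "Z' \<in> null_sets lborel" "{y. \<exists>x x'. x \<noteq> x' \<and> (x, y) \<in> S \<and> (x', y) \<in> S} \<subseteq> Z'"
    using Z unfolding negligible_iff_null_sets null_sets_completion_iff2 by blast
  then have bZ: "Z' \<in> sets borel" by auto
  have "emeasure \<Gamma> (UNIV \<times> Z') = 0"
    using Z'(1) ac emeasure_coupling_snd[OF \<Gamma> bZ] by (auto simp: absolutely_continuous_def)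
  then have null: "- S \<union> UNIV \<times> Z' \<in> null_sets \<Gamma>"
    using S bZ D(2) by (intro null_sets.Un) (auto simp: null_sets_def rect_ring_borel Times_in_rect_ring)
  have "AE z in \<Gamma>. z \<in> S \<and> snd z \<notin> Z'"
    by (rule AE_I'[OF null]) (auto simp: D(3))
  then have "AE z in \<Gamma>. z \<in> K \<times> UNIV \<longleftrightarrow> z \<in> UNIV \<times> ?P"
  proof eventually_elim
    case (elim z)
    obtain a b where z: "z = (a, b)" by (cases z)
    have "x = a" if "(x, b) \<in> S" for x
      using that elim Z'(2) unfolding z by auto
    then show ?case using elim z by auto
  qed
  then have "emeasure \<Gamma> (K \<times> UNIV) = emeasure \<Gamma> (UNIV \<times> ?P)"
    using bP bK D(2) by (intro emeasure_eq_AE) (auto simp: rect_ring_borel Times_in_rect_ring)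
  then show ?thesis
    using emeasure_coupling_fst[OF \<Gamma> bK] emeasure_coupling_snd[OF \<Gamma> bP] by simp
qed

section \<open>Averages of measures and of couplings\<close>

definition mix_measure :: "'a measure \<Rightarrow> 'a measure \<Rightarrow> 'a measure" where
  "mix_measure M N = scale_measure (1/2) (add_measure M N)"

lemma sets_mix_measure [simp, measurable_cong]: "sets (mix_measure M N) = sets M"
  by (simp add: mix_measure_def)

lemma space_mix_measure [simp]: "space (mix_measure M N) = space M"
  by (rule sets_eq_imp_space_eq) simp

lemma emeasure_mix_measure:
  "sets M = sets N \<Longrightarrow> A \<in> sets M \<Longrightarrow> emeasure (mix_measure M N) A = 1/2 * (emeasure M A + emeasure N A)"
  by (simp add: mix_measure_def emeasure_add_measure)

lemma nn_integral_mix_measure: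
  "sets M = sets N \<Longrightarrow> f \<in> borel_measurable M \<Longrightarrow>
    (\<integral>\<^sup>+ x. f x \<partial>mix_measure M N) = 1/2 * ((\<integral>\<^sup>+ x. f x \<partial>M) + (\<integral>\<^sup>+ x. f x \<partial>N))"
  by (simp add: mix_measure_def nn_integral_scale_measure nn_integral_add_measure cong: measurable_cong_sets)

lemma half_add_half_ennreal: "1/2 * (a + a) = (a::ennreal)"
  by (simp add: mult_2[symmetric] mult.assoc[symmetric] ennreal_divide_times)

lemma borel_probs_space: "M \<in> borel_probs \<Longrightarrow> space M = UNIV"
  using sets_eq_imp_space_eq[of M borel] by (simp add: borel_probs_def)

lemma mix_measure_borel_probs:
  assumes "M \<in> borel_probs" "N \<in> borel_probs"
  shows "mix_measure M N \<in> borel_probs"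
proof -
  have "emeasure M UNIV = 1" "emeasure N UNIV = 1"
    using assms prob_space.emeasure_space_1[of M] prob_space.emeasure_space_1[of N]
      borel_probs_space[of M] borel_probs_space[of N] by (simp_all add: borel_probs_def)
  then have "emeasure (mix_measure M N) UNIV = 1"
    using assms by (simp add: emeasure_mix_measure borel_probs_def half_add_half_ennreal del: one_add_one)
  moreover have "space (mix_measure M N) = UNIV"
    using assms by (simp add: borel_probs_space)
  ultimately show ?thesis
    using assms by (auto simp: borel_probs_def intro!: prob_spaceI)
qed

lemma mix_measure_couplings:
  fixes \<Gamma>1 \<Gamma>2 :: "('b::second_countable_topology \<times> 'b) measure"
  assumes "\<mu>1 \<in> borel_probs" "\<mu>2 \<in> borel_probs" "\<nu> \<in> borel_probs"
    and \<Gamma>: "\<Gamma>1 \<in> couplings \<mu>1 \<nu>" "\<Gamma>2 \<in> couplings \<mu>2 \<nu>"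
  shows "mix_measure \<Gamma>1 \<Gamma>2 \<in> couplings (mix_measure \<mu>1 \<mu>2) \<nu>"
proof (rule couplingsI)
  note D = couplingsD[OF \<Gamma>(1)] couplingsD[OF \<Gamma>(2)]
  fix A :: "'b set" assume A: "A \<in> sets borel"
  have "sets \<mu>1 = sets borel" "sets \<mu>2 = sets borel" using assms by (auto simp: borel_probs_def)
  moreover have "A \<times> (UNIV :: 'b set) \<in> sets borel" "(UNIV :: 'b set) \<times> A \<in> sets borel"
    using A by (simp_all add: rect_ring_borel Times_in_rect_ring)
  ultimately show "emeasure (mix_measure \<Gamma>1 \<Gamma>2) (A \<times> UNIV) = emeasure (mix_measure \<mu>1 \<mu>2) A"
    "emeasure (mix_measure \<Gamma>1 \<Gamma>2) (UNIV \<times> A) = emeasure \<nu> A"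
    using A D emeasure_coupling_fst[OF \<Gamma>(1) A] emeasure_coupling_fst[OF \<Gamma>(2) A]
      emeasure_coupling_snd[OF \<Gamma>(1) A] emeasure_coupling_snd[OF \<Gamma>(2) A]
    by (simp_all add: emeasure_mix_measure half_add_half_ennreal)
qed (use assms couplingsD(2)[OF \<Gamma>(1)] mix_measure_borel_probs in auto)

lemma distr_mix_measure:
  assumes "sets M = sets N" "f \<in> measurable M L"
  shows "distr (mix_measure M N) L f = mix_measure (distr M L f) (distr N L f)"
proof (rule measure_eqI)
  fix A assume "A \<in> sets (distr (mix_measure M N) L f)"
  then have A: "A \<in> sets L" by simp
  have sp: "space N = space M"
    using assms(1) by (rule sets_eq_imp_space_eq[symmetric])
  have f: "f \<in> measurable N L" "f \<in> measurable (mix_measure M N) L"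
    using assms by (simp_all cong: measurable_cong_sets)
  show "emeasure (distr (mix_measure M N) L f) A = emeasure (mix_measure (distr M L f) (distr N L f)) A"
    using A f assms measurable_sets[OF assms(2) A]
    by (simp add: emeasure_distr emeasure_mix_measure sp)
qed simp

abbreviation cost :: "real \<Rightarrow> 'b::real_normed_vector \<times> 'b \<Rightarrow> real" where
  "cost p z \<equiv> norm (fst z - snd z) powr p"

lemma continuous_cost: "p > 0 \<Longrightarrow> continuous_on UNIV (cost p)"
  by (intro continuous_on_powr' continuous_intros) auto

lemma wasserstein_pow_cost:
  "wasserstein_pow p \<mu> \<nu> = (INF \<Gamma>\<in>couplings \<mu> \<nu>. \<integral>\<^sup>+ z. ennreal (cost p z) \<partial>\<Gamma>)"
  by (simp add: wasserstein_pow_def case_prod_unfold)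

lemma wasserstein_pow_attained:
  fixes \<mu> \<nu> :: "'b::euclidean_space measure"
  assumes "\<mu> \<in> borel_probs" "\<nu> \<in> borel_probs" "p > 0"
  obtains \<Gamma> where "\<Gamma> \<in> couplings \<mu> \<nu>" "(\<integral>\<^sup>+ z. ennreal (cost p z) \<partial>\<Gamma>) = wasserstein_pow p \<mu> \<nu>"
proof -
  have "continuous_on UNIV (\<lambda>z::'b \<times> 'b. ennreal (cost p z))"
    using continuous_cost[OF assms(3)] by (intro continuous_on_ennreal)
  then have "open {z :: 'b \<times> 'b. a < ennreal (cost p z)}" for a
    by (intro open_Collect_less) auto
  then show ?thesis
    using that unfolding wasserstein_pow_cost
    by (rule optimal_coupling_exists[OF assms(1,2), of "\<lambda>z. ennreal (cost p z)"])
qed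

text \<open>The hypothesis \<open>mix\<close> is what minimality gives for an average of minimizers.
  Averaging optimal couplings yields one of cost \<open>m\<close> for the averaged marginal, so
  \<open>mix\<close> makes it optimal and its support monotone.\<close>

lemma wasserstein_pow_mix_eq_imp_eq:
  fixes \<mu>1 \<mu>2 \<nu> :: "'b::euclidean_space measure"
  assumes p: "p > 1" and \<mu>: "\<mu>1 \<in> borel_probs" "\<mu>2 \<in> borel_probs" and \<nu>: "\<nu> \<in> borel_probs"
    and ac: "absolutely_continuous lborel \<nu>"
    and m: "wasserstein_pow p \<mu>1 \<nu> = m" "wasserstein_pow p \<mu>2 \<nu> = m" "m < \<infinity>"
    and mix: "m \<le> wasserstein_pow p (mix_measure \<mu>1 \<mu>2) \<nu>"
  shows "\<mu>1 = \<mu>2"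
proof -
  have p0: "p > 0" using p by simp
  obtain \<Gamma>1 where \<Gamma>1: "\<Gamma>1 \<in> couplings \<mu>1 \<nu>" "(\<integral>\<^sup>+ z. ennreal (cost p z) \<partial>\<Gamma>1) = m"
    using wasserstein_pow_attained[OF \<mu>(1) \<nu> p0] m(1) by metis
  obtain \<Gamma>2 where \<Gamma>2: "\<Gamma>2 \<in> couplings \<mu>2 \<nu>" "(\<integral>\<^sup>+ z. ennreal (cost p z) \<partial>\<Gamma>2) = m"
    using wasserstein_pow_attained[OF \<mu>(2) \<nu> p0] m(2) by metis
  define \<Gamma> where "\<Gamma> = mix_measure \<Gamma>1 \<Gamma>2"
  define S where "S = measure_support \<Gamma>"
  have sts: "sets \<Gamma>1 = sets borel" "sets \<Gamma>2 = sets borel" "sets \<Gamma> = sets borel"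
    using couplingsD(2)[OF \<Gamma>1(1)] couplingsD(2)[OF \<Gamma>2(1)] by (simp_all add: \<Gamma>_def)
  have \<Gamma>: "\<Gamma> \<in> couplings (mix_measure \<mu>1 \<mu>2) \<nu>"
    unfolding \<Gamma>_def by (intro mix_measure_couplings \<mu> \<nu> \<Gamma>1 \<Gamma>2)
  have "(\<lambda>z. ennreal (cost p z)) \<in> borel_measurable (borel :: ('b \<times> 'b) measure)"
    using continuous_cost[OF p0] by (intro measurable_compose[OF _ measurable_ennreal] borel_measurable_continuous_onI)
  then have "(\<lambda>z. ennreal (cost p z)) \<in> borel_measurable \<Gamma>1"
    using sts by (simp cong: measurable_cong_sets)
  then have int: "(\<integral>\<^sup>+ z. ennreal (cost p z) \<partial>\<Gamma>) = m"
    unfolding \<Gamma>_def using sts \<Gamma>1 \<Gamma>2 by (simp add: nn_integral_mix_measure half_add_half_ennreal)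
  have mono: "cost p (x, y) + cost p (x', y') \<le> cost p (x, y') + cost p (x', y)"
    if "(x, y) \<in> S" "(x', y') \<in> S" for x y x' y'
  proof (rule optimal_coupling_monotone[OF continuous_cost[OF p0] _ mix_measure_borel_probs[OF \<mu>] \<nu> \<Gamma>])
    fix \<Gamma>' assume "\<Gamma>' \<in> couplings (mix_measure \<mu>1 \<mu>2) \<nu>"
    then have "wasserstein_pow p (mix_measure \<mu>1 \<mu>2) \<nu> \<le> (\<integral>\<^sup>+ z. ennreal (cost p z) \<partial>\<Gamma>')"
      unfolding wasserstein_pow_cost by (rule INF_lower)
    then show "(\<integral>\<^sup>+ z. ennreal (cost p z) \<partial>\<Gamma>) \<le> (\<integral>\<^sup>+ z. ennreal (cost p z) \<partial>\<Gamma>')"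
      using mix int by simp
  qed (use that int m(3) in \<open>auto simp: S_def measure_support_def\<close>)
  have S: "closed S" unfolding S_def by (rule closed_measure_support[OF sts(3)])
  have Z: "negligible {y. \<exists>x x'. x \<noteq> x' \<and> (x, y) \<in> S \<and> (x', y) \<in> S}"
    using mono by (intro monotone_multivalued_negligible[OF p S]) simp
  have "emeasure \<Gamma> (- S) = 0" unfolding S_def by (rule emeasure_Compl_support[OF sts(3)])
  \<comment> \<open>Each of the two couplings is at most twice their average, so both vanish off
    \<open>S\<close>.\<close>
  then have null: "emeasure \<Gamma>1 (- S) = 0" "emeasure \<Gamma>2 (- S) = 0"
    using sts S by (auto simp: \<Gamma>_def emeasure_mix_measure)
  have "finite_measure \<mu>1" "finite_measure \<mu>2" "sets \<mu>1 = sets borel" "sets \<mu>2 = sets borel"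
    using \<mu> by (auto simp: borel_probs_def prob_space_def)
  \<comment> \<open>The right-hand side of \<open>coupling_fst_marginal_eq\<close> depends on
    \<open>\<nu>\<close>, \<open>S\<close> and \<open>K\<close> but not on the coupling, so both
    first marginals agree on compact sets.\<close>
  then show ?thesis
    using coupling_fst_marginal_eq[OF \<Gamma>1(1) ac S null(1) Z] coupling_fst_marginal_eq[OF \<Gamma>2(1) ac S null(2) Z]
    by (intro measure_eqI_compact) auto
qed

section \<open>Feasibility and the final assembly\<close>

lemma feasible_borel_probs_moment:
  fixes \<phi> :: "'x::topological_space \<Rightarrow> 'b::euclidean_space"
  assumes p: "p > 0" and \<nu>: "\<nu> \<in> borel_probs_moment p" and \<phi>: "\<phi> \<in> borel_measurable borel"
  shows "feasible p \<phi> \<nu>"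
proof -
  \<comment> \<open>Types are inhabited; this is where nonemptiness of the Polish space
    enters.\<close>
  fix x0 :: 'x
  define a where "a = \<phi> x0"
  have \<nu>p: "\<nu> \<in> borel_probs" and fin: "(\<integral>\<^sup>+ y. ennreal (norm y powr p) \<partial>\<nu>) < \<infinity>"
    using \<nu> by (auto simp: borel_probs_moment_def)
  interpret prob_space \<nu> using \<nu>p by (simp add: borel_probs_def)
  have [measurable_cong]: "sets \<nu> = sets borel" using \<nu>p by (simp add: borel_probs_def)
  have sp: "space \<nu> = UNIV" using \<nu>p by (rule borel_probs_space)
  have dirac: "return borel z \<in> borel_probs" for z :: "'c::topological_space"
    by (simp add: borel_probs_def prob_space_return)
  have push: "distr (return borel x0) borel \<phi> = return borel a"
    using \<phi> by (simp add: distr_return a_def)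
  have [measurable]: "Pair a \<in> borel_measurable \<nu>"
    by (simp add: borel_prod[symmetric])
  \<comment> \<open>The product of the Dirac mass at \<open>a\<close> with \<open>\<nu>\<close>,
    written as an image of \<open>\<nu>\<close>.\<close>
  define \<Gamma> where "\<Gamma> = distr \<nu> borel (Pair a)"
  have "\<Gamma> \<in> couplings (return borel a) \<nu>"
  proof (rule couplingsI[OF _ dirac \<nu>p])
    fix A :: "'b set" assume A: "A \<in> sets borel"
    then have "A \<times> (UNIV :: 'b set) \<in> sets borel" "(UNIV :: 'b set) \<times> A \<in> sets borel"
      by (simp_all add: rect_ring_borel Times_in_rect_ring)
    moreover have "Pair a -` (A \<times> UNIV) = (if a \<in> A then UNIV else {})" "Pair a -` (UNIV \<times> A) = A" by auto
    ultimately show "emeasure \<Gamma> (A \<times> UNIV) = emeasure (return borel a) A" "emeasure \<Gamma> (UNIV \<times> A) = emeasure \<nu> A"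
      using A emeasure_space_1 by (simp_all add: \<Gamma>_def emeasure_distr sp)
  qed (simp add: \<Gamma>_def)
  then have "wasserstein_pow p (return borel a) \<nu> \<le> (\<integral>\<^sup>+ z. ennreal (cost p z) \<partial>\<Gamma>)"
    unfolding wasserstein_pow_cost by (rule INF_lower)
  also have "\<dots> = (\<integral>\<^sup>+ y. ennreal (norm (a - y) powr p) \<partial>\<nu>)"
  proof -
    have "(\<lambda>z. ennreal (cost p z)) \<in> borel_measurable (borel :: ('b \<times> 'b) measure)"
      using continuous_cost[OF p] by (intro measurable_compose[OF _ measurable_ennreal] borel_measurable_continuous_onI)
    then show ?thesis unfolding \<Gamma>_def by (subst nn_integral_distr) auto
  qed
  also have "\<dots> \<le> (\<integral>\<^sup>+ y. ennreal (2 powr p * norm a powr p) + ennreal (2 powr p) * ennreal (norm y powr p) \<partial>\<nu>)"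
  proof (rule nn_integral_mono)
    fix y
    have "norm (a - y) \<le> 2 * max (norm a) (norm y)"
      using norm_triangle_ineq4[of a y] by linarith
    then have "norm (a - y) powr p \<le> (2 * max (norm a) (norm y)) powr p"
      using p by (intro powr_mono2) auto
    also have "\<dots> = 2 powr p * max (norm a) (norm y) powr p" by (simp add: powr_mult)
    also have "\<dots> \<le> 2 powr p * (norm a powr p + norm y powr p)"
      by (intro mult_left_mono) (auto simp: max_def)
    finally show "ennreal (norm (a - y) powr p)
        \<le> ennreal (2 powr p * norm a powr p) + ennreal (2 powr p) * ennreal (norm y powr p)"
      by (simp add: distrib_left flip: ennreal_mult ennreal_plus)
  qed
  also have "\<dots> = ennreal (2 powr p * norm a powr p) + ennreal (2 powr p) * (\<integral>\<^sup>+ y. ennreal (norm y powr p) \<partial>\<nu>)"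
    by (simp add: nn_integral_add nn_integral_cmult emeasure_space_1)
  also have "\<dots> < \<infinity>"
    using fin by (simp add: ennreal_mult_less_top)
  finally have "objective p \<phi> \<nu> (return borel x0) < \<infinity>"
    by (simp add: objective_def push)
  moreover have "(INF \<sigma>\<in>borel_probs. objective p \<phi> \<nu> \<sigma>) \<le> objective p \<phi> \<nu> (return borel x0)"
    by (rule INF_lower) (rule dirac)
  ultimately show ?thesis unfolding feasible_def by (rule le_less_trans[rotated])
qed

lemma minimizer_unique:
  fixes \<phi> :: "'x::polish_space \<Rightarrow> 'b::euclidean_space"
  assumes p: "p > 1" and \<nu>: "\<nu> \<in> borel_probs" and ac: "absolutely_continuous lborel \<nu>"
    and \<phi>: "\<phi> \<in> borel_measurable borel" "inj \<phi>" and feas: "feasible p \<phi> \<nu>"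
    and min: "is_minimizer p \<phi> \<nu> \<sigma>1" "is_minimizer p \<phi> \<nu> \<sigma>2"
  shows "\<sigma>1 = \<sigma>2"
proof -
  have \<sigma>: "\<sigma>1 \<in> borel_probs" "\<sigma>2 \<in> borel_probs" using min by (auto simp: is_minimizer_def)
  have \<sigma>': "sets \<sigma>1 = sets borel" "finite_measure \<sigma>1" "sets \<sigma>2 = sets borel" "finite_measure \<sigma>2"
    using \<sigma> by (auto simp: borel_probs_def prob_space_def)
  have meas: "\<phi> \<in> borel_measurable \<sigma>" if "\<sigma> \<in> borel_probs" for \<sigma>
    using \<phi>(1) that by (simp add: borel_probs_def cong: measurable_cong_sets)
  have push: "distr \<sigma> borel \<phi> \<in> borel_probs" if "\<sigma> \<in> borel_probs" for \<sigma>
    using that meas[OF that] by (simp add: borel_probs_def prob_space.prob_space_distr)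
  let ?m = "INF \<sigma>\<in>borel_probs. objective p \<phi> \<nu> \<sigma>"
  have "distr \<sigma>1 borel \<phi> = distr \<sigma>2 borel \<phi>"
  proof (rule wasserstein_pow_mix_eq_imp_eq[OF p push[OF \<sigma>(1)] push[OF \<sigma>(2)] \<nu> ac])
    show "wasserstein_pow p (distr \<sigma>1 borel \<phi>) \<nu> = ?m" "wasserstein_pow p (distr \<sigma>2 borel \<phi>) \<nu> = ?m"
      using min by (auto simp: is_minimizer_def objective_def)
    show "?m < \<infinity>" using feas by (simp add: feasible_def)
    \<comment> \<open>The average is formed on the source space, where it is admissible; pushing
      forward commutes with averaging.\<close>
    have "?m \<le> objective p \<phi> \<nu> (mix_measure \<sigma>1 \<sigma>2)"
      by (intro INF_lower mix_measure_borel_probs \<sigma>)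
    then show "?m \<le> wasserstein_pow p (mix_measure (distr \<sigma>1 borel \<phi>) (distr \<sigma>2 borel \<phi>)) \<nu>"
      using \<sigma>' meas[OF \<sigma>(1)] by (simp add: objective_def distr_mix_measure)
  qed
  then show ?thesis by (rule distr_inj_eqD[OF \<sigma>' \<phi>])
qed

theorem corollary1p4:
  fixes \<phi> :: "'x::polish_space \<Rightarrow> real ^ 'd"
    and \<nu> :: "(real ^ 'd) measure"
    and p :: real
  assumes "p > 1"
    and "\<nu> \<in> borel_probs_moment p"
    and "absolutely_continuous lborel \<nu>"
    and "\<phi> \<in> borel_measurable borel"
    and "inj \<phi>"
  shows "(\<forall>\<sigma>1 \<sigma>2. is_minimizer p \<phi> \<nu> \<sigma>1 \<and> is_minimizer p \<phi> \<nu> \<sigma>2 \<longrightarrow> \<sigma>1 = \<sigma>2)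
           \<longleftrightarrow> feasible p \<phi> \<nu>"
proof -
  have "feasible p \<phi> \<nu>" using assms by (intro feasible_borel_probs_moment) auto
  moreover have "\<nu> \<in> borel_probs" using assms(2) by (simp add: borel_probs_moment_def)
  ultimately show ?thesis using assms minimizer_unique by blast
qed

end
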